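(* Let $1<p,q<\infty$ and $n\in\mathbb N$ (positive integer). (i) On an interval $\mathcal I=[0,t_0]$, $t_0>0$, there is a unique spectral couple $(f,\lambda)$ such that $f$ has $n-1$ distinct zeros in the interior of $\mathcal I$. (ii) Let $(f_1,\lambda_1)$ be the spectral couple on $[0,1]$ where $\lambda_1$ is the first spectral number. Let $f_{1*}:\mathbb R\to\mathbb R$ be the $2$-periodic odd function such that $f_{1*}(t)=f_1(t)$ for all $t\in[0,1]$. Then $$\left(f_n(t)=\frac{f_{1*}(nt)}{n^2},\quad \lambda_n=n^{2q}\lambda_1\right)$$ is the spectral couple on $[0,1]$ associated to the $n$-th spectral number. (iii) Let $(f_n,\lambda_n)$ be the $n$-th spectral couple on $[0,1]$ given in (ii). Then $$\left(\mathrm{SN}_n(t)=t_0^{2-1/p}f_n(t/t_0),\quad \mathrm{sn}_n=t_0^{q/p-1-2q}\lambda_n\right)$$ is the spectral couple on $\mathcal I=[0,t_0]$ which has $n-1$ distinct zeros in $(0,t_0)$. In particular, $$\mathrm{SN}_n(t)=\frac{t_0^{2-1/p}}{n^2}f_{1*}(nt/t_0)\qquad\text{and}\qquad \mathrm{sn}_n=n^{2q}t_0^{q/p-1-2q}\lambda_1$$ are the $n$-th spectral function and the $n$-th spectral number on $\mathcal I$, respectively.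
   Context: On an interval $[0,t_0]$ consider the eigenvalue problem $(\operatorname{sgn}(u'')|u''|^{p-1})''=\lambda\operatorname{sgn}(u)|u|^{q-1}$ on $[0,t_0]$, $u(0)=u(t_0)=u''(0)=u''(t_0)=0$, with $u\not\equiv0$ and $\lambda>0$; solutions are such that $u$, $u'$, $\operatorname{sgn}(u'')|u''|^{p-1}$ and $(\operatorname{sgn}(u'')|u''|^{p-1})'$ are $C^1$ on $[0,t_0]$. A spectral couple on $[0,t_0]$ is an eigenpair $(f,\lambda)$ normalized by $\|f''\|_{L^p}=1$ and $f'(0)>0$; $f$ is called a spectral function and $\lambda$ a spectral number. Spectral numbers are listed in increasing order, so the first one is the smallest, and the $n$-th spectral couple (function) is the one associated to the $n$-th spectral number. *)

theory Defs
  imports "HOL-Analysis.Analysis"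
begin

text \<open>
  Functions on an interval are total functions on the reals of which only the values on the
  interval matter. Accordingly, derivatives are taken within the interval, so they are one-sided
  at the endpoints, and uniqueness means agreement on the interval.
\<close>

definition deriv_on :: "real set \<Rightarrow> (real \<Rightarrow> real) \<Rightarrow> real \<Rightarrow> real" where
  "deriv_on S f t = vector_derivative f (at t within S)"

definition C1_on :: "real set \<Rightarrow> (real \<Rightarrow> real) \<Rightarrow> bool" where
  "C1_on S f \<longleftrightarrow> f differentiable_on S \<and> continuous_on S (deriv_on S f)"

definition signed_pow :: "real \<Rightarrow> real \<Rightarrow> real" where
  "signed_pow r x = sgn x * \<bar>x\<bar> powr (r - 1)"

definition Lp_norm_on :: "real \<Rightarrow> real set \<Rightarrow> (real \<Rightarrow> real) \<Rightarrow> real" where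
  "Lp_norm_on p S g = (LINT t:S|lborel. \<bar>g t\<bar> powr p) powr (1 / p)"

definition eigenpair :: "real \<Rightarrow> real \<Rightarrow> real \<Rightarrow> (real \<Rightarrow> real) \<Rightarrow> real \<Rightarrow> bool" where
  "eigenpair p q t0 u l \<longleftrightarrow>
    (let I = {0..t0};
         u' = deriv_on I u;
         u'' = deriv_on I u';
         w = (\<lambda>t. signed_pow p (u'' t));
         w' = deriv_on I w
     in C1_on I u \<and> C1_on I u' \<and> C1_on I w \<and> C1_on I w' \<and>
        (\<forall>t\<in>I. deriv_on I w' t = l * signed_pow q (u t)) \<and>
        u 0 = 0 \<and> u t0 = 0 \<and> u'' 0 = 0 \<and> u'' t0 = 0 \<and>
        (\<exists>t\<in>I. u t \<noteq> 0) \<and> l > 0)"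

definition spectral_couple :: "real \<Rightarrow> real \<Rightarrow> real \<Rightarrow> (real \<Rightarrow> real) \<Rightarrow> real \<Rightarrow> bool" where
  "spectral_couple p q t0 f l \<longleftrightarrow>
    eigenpair p q t0 f l \<and>
    Lp_norm_on p {0..t0} (deriv_on {0..t0} (deriv_on {0..t0} f)) = 1 \<and>
    deriv_on {0..t0} f 0 > 0"

definition spectral_numbers :: "real \<Rightarrow> real \<Rightarrow> real \<Rightarrow> real set" where
  "spectral_numbers p q t0 = {l. \<exists>f. spectral_couple p q t0 f l}"

text \<open>
  The position of a spectral number in the increasing enumeration (starting from 1, without
  repetitions) is one more than the number of smaller spectral numbers, of which there must be
  only finitely many.
\<close>

definition nth_spectral_number :: "real \<Rightarrow> real \<Rightarrow> real \<Rightarrow> nat \<Rightarrow> real \<Rightarrow> bool" where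
  "nth_spectral_number p q t0 n l \<longleftrightarrow>
    l \<in> spectral_numbers p q t0 \<and>
    finite {m \<in> spectral_numbers p q t0. m < l} \<and>
    Suc (card {m \<in> spectral_numbers p q t0. m < l}) = n"

definition nth_spectral_couple ::
    "real \<Rightarrow> real \<Rightarrow> real \<Rightarrow> nat \<Rightarrow> (real \<Rightarrow> real) \<Rightarrow> real \<Rightarrow> bool" where
  "nth_spectral_couple p q t0 n f l \<longleftrightarrow>
    spectral_couple p q t0 f l \<and> nth_spectral_number p q t0 n l"

definition spectral_couple_with_zeros ::
    "real \<Rightarrow> real \<Rightarrow> real \<Rightarrow> nat \<Rightarrow> (real \<Rightarrow> real) \<Rightarrow> real \<Rightarrow> bool" where
  "spectral_couple_with_zeros p q t0 k f l \<longleftrightarrow>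
    spectral_couple p q t0 f l \<and>
    finite {t \<in> {0<..<t0}. f t = 0} \<and> card {t \<in> {0<..<t0}. f t = 0} = k"

definition is_the_couple ::
    "real \<Rightarrow> ((real \<Rightarrow> real) \<Rightarrow> real \<Rightarrow> bool) \<Rightarrow> (real \<Rightarrow> real) \<Rightarrow> real \<Rightarrow> bool" where
  "is_the_couple t0 P f l \<longleftrightarrow>
    P f l \<and> (\<forall>g m. P g m \<longrightarrow> m = l \<and> (\<forall>t\<in>{0..t0}. g t = f t))"

definition odd_2periodic_extension :: "(real \<Rightarrow> real) \<Rightarrow> (real \<Rightarrow> real) \<Rightarrow> bool" where
  "odd_2periodic_extension f g \<longleftrightarrow>
    (\<forall>t. g (t + 2) = g t) \<and> (\<forall>t. g (- t) = - g t) \<and> (\<forall>t\<in>{0..1}. g t = f t)"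

end

theory Submission
  imports Defs "HOL-Complex_Analysis.Great_Picard"
begin

text \<open>
  With \<open>w = signed_pow p u''\<close> and \<open>p' = p / (p - 1)\<close> the equation becomes the system
  \<open>u'' = signed_pow p' w\<close>, \<open>w'' = l * signed_pow q u\<close>, whose right-hand sides are increasing. The
  boundary conditions allow every eigenfunction to be extended to an odd periodic solution on the
  whole line. If two such solutions have the same slope \<open>u' 0\<close> but different slopes \<open>w' 0\<close>, then
  monotonicity makes the difference of the \<open>w\<close>'s grow at least linearly, contradicting boundedness.
  Hence \<open>u' 0\<close> determines both slopes at 0, and thereby the whole solution as long as one of the two
  has only simple zeros.

  On \<open>[0, 1]\<close> a solution with \<open>u > 0 > w\<close> inside is obtained by maximizing the integral of \<open>(G h)^q\<close>
  subject to \<open>\<integral>h^p = 1\<close>, \<open>h \<ge> 0\<close>, where \<open>G\<close> is Green's operator. Its extension has simple zeros,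
  exactly at the integers, and its rescalings realize every pair of \<open>l\<close> and \<open>u' 0\<close>; so every
  eigenfunction on \<open>[0, t0]\<close> is a rescaling whose zeros include \<open>t0\<close>.
\<close>

subsection \<open>Signed powers\<close>

text \<open>For \<open>p > 2\<close> or \<open>q < 2\<close> a right-hand side of the system fails
  to be Lipschitz at 0, so Picard-Lindelof uniqueness does not apply, and nothing excludes
  beforehand that an unknown eigenfunction has degenerate zeros. This is why simplicity of zeros is
  demanded of only one of the two compared solutions: it can be checked for the positive arch. The
  four initial values shrink to one: oddness removes \<open>u 0\<close> and \<open>w 0\<close>,
  boundedness ties \<open>w' 0\<close> to \<open>u' 0\<close>. The two data left, \<open>l\<close>
  and \<open>u' 0\<close>, are matched by the two scaling parameters of the arch, amplitude and
  frequency. The maximization runs over \<open>h = - u''\<close> and not over \<open>u\<close>,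
  because a bound on the integral of \<open>h\<close> makes \<open>G h\<close> uniformly Lipschitz.
  Along a maximizing sequence a subsequence of \<open>G h\<close> converges uniformly to some
  \<open>u\<close>, although \<open>h\<close> itself need not converge. No weak limit of
  \<open>h\<close> is taken and the functional is never differentiated: the equality case of Young's
  inequality builds a candidate from \<open>u\<close>, and a second use of Young shows that
  \<open>G\<close> maps this candidate to \<open>u\<close>.\<close>

lemma signed_pow_nonneg: "0 \<le> x \<Longrightarrow> signed_pow r x = x powr (r - 1)"
  by (auto simp: signed_pow_def sgn_if)

lemma signed_pow_0 [simp]: "signed_pow r 0 = 0"
  by (simp add: signed_pow_def)

lemma signed_pow_minus [simp]: "signed_pow r (- x) = - signed_pow r x"
  by (simp add: signed_pow_def sgn_minus)

lemma abs_signed_pow: "\<bar>signed_pow r x\<bar> = \<bar>x\<bar> powr (r - 1)"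
  by (auto simp: signed_pow_def abs_mult sgn_if)

lemma sgn_signed_pow: "sgn (signed_pow r x) = sgn x"
  by (auto simp: signed_pow_def sgn_if mult_less_0_iff)

lemma signed_pow_scale: "0 \<le> c \<Longrightarrow> signed_pow r (c * x) = c powr (r - 1) * signed_pow r x"
  by (auto simp: signed_pow_def sgn_if abs_mult powr_mult zero_less_mult_iff)

text \<open>\<open>signed_pow r\<close> is the odd power of degree \<open>r - 1\<close>, so degrees
  with product 1 give inverse functions. With conjugate exponents this recovers \<open>u''\<close>
  from \<open>w\<close>.\<close>

lemma signed_pow_signed_pow:
  assumes "(r - 1) * (s - 1) = 1"
  shows "signed_pow r (signed_pow s x) = x"
  using assms by (simp add: signed_pow_def[of r] sgn_signed_pow abs_signed_pow powr_powr
      mult.commute[of _ "r - 1"] sgn_mult_abs)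

text \<open>Both powers have nonnegative bases, so monotonicity and continuity across 0 follow
  without a case distinction on signs.\<close>

lemma signed_pow_conv_max:
  "signed_pow r x = max x 0 powr (r - 1) - max (- x) 0 powr (r - 1)"
  by (auto simp: signed_pow_def sgn_if max_def)

lemma mono_signed_pow: "1 < r \<Longrightarrow> x \<le> y \<Longrightarrow> signed_pow r x \<le> signed_pow r y"
  unfolding signed_pow_conv_max by (intro diff_mono powr_mono2) auto

lemma continuous_on_signed_pow:
  "1 < r \<Longrightarrow> continuous_on S f \<Longrightarrow> continuous_on S (\<lambda>x. signed_pow r (f x))"
  unfolding signed_pow_conv_max by (intro continuous_intros continuous_on_powr') auto

lemma signed_pow_locally_Lipschitz:
  assumes "x0 \<noteq> 0"
  obtains d L where "0 < d" "0 < L"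
    "\<And>x y. \<bar>x - x0\<bar> < d \<Longrightarrow> \<bar>y - x0\<bar> < d \<Longrightarrow> \<bar>signed_pow r x - signed_pow r y\<bar> \<le> L * \<bar>x - y\<bar>"
proof -
  have pos: "\<exists>d L. 0 < d \<and> 0 < L \<and> (\<forall>x y. \<bar>x - z\<bar> < d \<longrightarrow> \<bar>y - z\<bar> < d \<longrightarrow>
      \<bar>signed_pow r x - signed_pow r y\<bar> \<le> L * \<bar>x - y\<bar>)" if z: "0 < z" for z
  proof -
    \<comment> \<open>A compact neighbourhood of \<open>z\<close> that stays away from 0, where the
      derivative of the power may blow up. Negative points follow from oddness.\<close>
    define S where "S = {z/2..2*z}"
    have "continuous_on S (\<lambda>x. (r - 1) * x powr (r - 2))"
      unfolding S_def using z by (intro continuous_intros) auto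
    then have "bounded ((\<lambda>x. (r - 1) * x powr (r - 2)) ` S)"
      by (intro compact_imp_bounded compact_continuous_image) (auto simp: S_def)
    then obtain L where L: "0 < L" "\<And>x. x \<in> S \<Longrightarrow> \<bar>(r - 1) * x powr (r - 2)\<bar> \<le> L"
      unfolding bounded_pos by auto
    have "\<bar>x powr (r-1) - y powr (r-1)\<bar> \<le> L * \<bar>x - y\<bar>" if "x \<in> S" "y \<in> S" for x y
    proof -
      have "norm (x powr (r-1) - y powr (r-1)) \<le> L * norm (x - y)"
      proof (rule field_differentiable_bound[of S])
        show "((\<lambda>x. x powr (r-1)) has_field_derivative (r - 1) * x powr (r - 2)) (at x within S)"
          if "x \<in> S" for x
        proof -
          have "0 < x" using that z by (auto simp: S_def)
          from has_real_derivative_powr[OF this, of "r - 1"]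
          show ?thesis by (simp add: has_field_derivative_at_within)
        qed
      qed (use that L in \<open>auto simp: S_def\<close>)
      then show ?thesis by simp
    qed
    moreover have "x \<in> S \<and> 0 \<le> x" if "\<bar>x - z\<bar> < z/2" for x
      using that z by (auto simp: S_def abs_real_def split: if_splits)
    ultimately show ?thesis
      using z L(1) by (intro exI[of _ "z/2"] exI[of _ L]) (auto simp: signed_pow_nonneg)
  qed
  show ?thesis
  proof (cases "0 < x0")
    case True
    with pos that show ?thesis by metis
  next
    case False
    with assms have "0 < - x0" by simp
    from pos[OF this] obtain d L where *: "0 < d" "0 < L"
      "\<And>x y. \<bar>x - (-x0)\<bar> < d \<Longrightarrow> \<bar>y - (-x0)\<bar> < d \<Longrightarrow> \<bar>signed_pow r x - signed_pow r y\<bar> \<le> L * \<bar>x - y\<bar>"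
      by blast
    have "\<bar>signed_pow r x - signed_pow r y\<bar> \<le> L * \<bar>x - y\<bar>"
      if "\<bar>x - x0\<bar> < d" "\<bar>y - x0\<bar> < d" for x y
      using *(3)[of "-x" "-y"] that by (simp add: abs_minus_commute)
    with * that show ?thesis by blast
  qed
qed

subsection \<open>Odd and even periodic functions\<close>

text \<open>\<open>s\<close> is the parity (1 even, -1 odd) and \<open>T\<close> is half the period.
  Thus \<open>{0..T}\<close> is a fundamental domain for the reflections and translations, and the
  length of the eigenvalue interval is the parameter.\<close>

definition sym_periodic :: "real \<Rightarrow> real \<Rightarrow> (real \<Rightarrow> real) \<Rightarrow> bool" where
  "sym_periodic s T F \<longleftrightarrow> (\<forall>t. F (- t) = s * F t) \<and> (\<forall>t. F (t + 2 * T) = F t)"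

lemma sym_periodic_minus: "sym_periodic s T F \<Longrightarrow> F (- t) = s * F t"
  by (simp add: sym_periodic_def)

lemma sym_periodic_add_int:
  assumes "sym_periodic s T F"
  shows "F (t + of_int k * (2 * T)) = F t"
proof -
  have *: "F (t + of_nat n * (2 * T)) = F t" for n t
  proof (induction n)
    case (Suc n)
    have "F (t + of_nat (Suc n) * (2 * T)) = F ((t + of_nat n * (2 * T)) + 2 * T)"
      by (simp add: algebra_simps)
    with Suc assms show ?case by (simp add: sym_periodic_def)
  qed simp
  show ?thesis
  proof (cases "0 \<le> k")
    case True
    with *[of t "nat k"] show ?thesis by simp
  next
    case False
    with *[of "t + of_int k * (2 * T)" "nat (- k)"] show ?thesis by simp
  qed
qed

lemma sym_periodic_mult_nat:
  assumes "sym_periodic s T F"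
  shows "sym_periodic s (of_nat n * T) F"
  using assms sym_periodic_add_int[OF assms, of _ "int n"]
  by (simp add: sym_periodic_def mult.left_commute)

lemma sym_periodic_scale:
  assumes "sym_periodic s T F" "a \<noteq> 0"
  shows "sym_periodic s (T / a) (\<lambda>t. c * F (a * t))"
  using assms by (simp add: sym_periodic_def distrib_left)

text \<open>Every multiple of \<open>T\<close> is fixed by a reflection up to a period, so an odd
  function equals its own negative there.\<close>

lemma sym_periodic_odd_zero:
  assumes "sym_periodic (- 1) T F"
  shows "F (of_int k * T) = 0"
proof -
  have "F (of_int k * T) = F (- (of_int k * T) + of_int k * (2 * T))"
    by (simp add: algebra_simps)
  also have "\<dots> = - F (of_int k * T)"
    unfolding sym_periodic_add_int[OF assms] using sym_periodic_minus[OF assms] by simp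
  finally show ?thesis by simp
qed

lemma periodic_reduce:
  fixes t T :: real
  assumes "0 < T"
  obtains k r where "t = r + of_int k * (2 * T)" "- T \<le> r" "r < T"
proof -
  define k where "k = \<lfloor>(t + T) / (2 * T)\<rfloor>"
  have "of_int k \<le> (t + T) / (2 * T)" "(t + T) / (2 * T) < of_int k + 1"
    by (auto simp: k_def)
  then show ?thesis
    using assms by (intro that[of "t - of_int k * (2 * T)" k]) (auto simp: field_simps)
qed

lemma sym_periodic_eqI:
  assumes F: "sym_periodic s T F" and G: "sym_periodic s T G" and "0 < T"
    and eq: "\<And>t. t \<in> {0..T} \<Longrightarrow> F t = G t"
  shows "F t = G t"
proof -
  obtain k r where r: "t = r + of_int k * (2 * T)" "- T \<le> r" "r < T"
    using periodic_reduce[OF \<open>0 < T\<close>] .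
  have "F r = G r"
  proof (cases "0 \<le> r")
    case False
    with r eq[of "- r"] have "F (- r) = G (- r)" by simp
    then show ?thesis using sym_periodic_minus[OF F, of "-r"] sym_periodic_minus[OF G, of "-r"] by simp
  qed (use r eq in auto)
  then show ?thesis by (simp add: r(1) sym_periodic_add_int[OF F] sym_periodic_add_int[OF G])
qed

text \<open>The points 0 and \<open>T\<close> are the fixed points of the reflections modulo the
  period; an odd extension therefore exists only if both endpoint values vanish, while an even one
  always does.\<close>

lemma sym_periodic_exists:
  fixes f :: "real \<Rightarrow> real"
  assumes "0 < T" "s = 1 \<or> s = - 1 \<and> f 0 = 0 \<and> f T = 0"
  obtains F where "sym_periodic s T F" "\<And>t. t \<in> {0..T} \<Longrightarrow> F t = f t"
proof -
  define r where "r t = t - of_int \<lfloor>(t + T) / (2 * T)\<rfloor> * (2 * T)" for t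
  define F where "F t = (if 0 \<le> r t then f (r t) else s * f (- r t))" for t
  have r_eq: "r x = y" if "x = y + of_int k * (2 * T)" "- T \<le> y" "y < T" for x y k
  proof -
    have "\<lfloor>(x + T) / (2 * T)\<rfloor> = k"
      using that assms(1) by (intro floor_unique) (auto simp: field_simps)
    then show ?thesis by (simp add: r_def that(1))
  qed
  have "F (t + 2 * T) = F t" and "F (- t) = s * F t" for t
  proof -
    obtain k y where y: "t = y + of_int k * (2 * T)" "- T \<le> y" "y < T"
      using periodic_reduce[OF \<open>0 < T\<close>] .
    have rt: "r t = y" using r_eq[OF y] .
    have "r (t + 2 * T) = y"
      using y by (intro r_eq[of _ _ "k + 1"]) (auto simp: algebra_simps)
    with rt show "F (t + 2 * T) = F t" by (simp add: F_def)
    show "F (- t) = s * F t"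
    proof (cases "y = - T")
      case True
      have "r (- t) = y"
        using y True \<open>0 < T\<close> by (intro r_eq[of _ _ "1 - k"]) (auto simp: algebra_simps)
      with True rt assms show ?thesis by (auto simp: F_def)
    next
      case False
      have "r (- t) = - y"
        using y False by (intro r_eq[of _ _ "- k"]) auto
      with rt assms(2) show ?thesis by (auto simp: F_def)
    qed
  qed
  then have "sym_periodic s T F" by (simp add: sym_periodic_def)
  moreover have "F t = f t" if "t \<in> {0..T}" for t
  proof (cases "t = T")
    case True
    have "r t = - T" using True \<open>0 < T\<close> by (intro r_eq[of _ _ 1]) auto
    with True assms show ?thesis by (auto simp: F_def)
  next
    case False
    have "r t = t" using False that assms(1) by (intro r_eq[of _ _ 0]) auto
    with that show ?thesis by (simp add: F_def)
  qed
  ultimately show ?thesis using that by blast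
qed

lemma DERIV_glue:
  fixes f :: "real \<Rightarrow> real"
  assumes "(f has_real_derivative D) (at x within {a..x})" "(f has_real_derivative D) (at x within {x..b})"
    and "a < x" "x < b"
  shows "(f has_real_derivative D) (at x)"
  using assms by (simp add: has_field_derivative_iff at_within_Icc_at_left at_within_Icc_at_right
      filterlim_split_at)

text \<open>Reflection carries the derivative to \<open>{-T..0}\<close> and translation to all other
  intervals. Only at multiples of \<open>T\<close> do two one-sided derivatives meet; they agree
  because differentiation reverses parity and \<open>F1\<close> is defined on the whole
  line.\<close>

lemma sym_periodic_has_derivative:
  assumes F: "sym_periodic s T F" and F1: "sym_periodic (- s) T F1" and "0 < T"
    and s: "s = 1 \<or> s = - 1"
    and der: "\<And>t. t \<in> {0..T} \<Longrightarrow> (F has_real_derivative F1 t) (at t within {0..T})"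
  shows "(F has_real_derivative F1 t) (at t)"
proof -
  have neg: "(F has_real_derivative F1 t) (at t within {-T..0})" if "t \<in> {-T..0}" for t
  proof -
    have im: "uminus ` {-T..0} = {0..T}" by simp
    have "(F has_real_derivative F1 (- t)) (at (- t) within uminus ` {-T..0})"
      unfolding im using der[of "- t"] that by auto
    moreover have "(uminus has_real_derivative - 1) (at t within {-T..0})"
      by (auto intro!: derivative_eq_intros)
    ultimately have "((F \<circ> uminus) has_real_derivative F1 (- t) * - 1) (at t within {-T..0})"
      by (rule DERIV_image_chain)
    from DERIV_cmult[OF this, of s]
    have "((\<lambda>t. s * F (- t)) has_real_derivative s * (F1 (- t) * - 1)) (at t within {-T..0})"
      by (simp add: o_def)
    moreover have "(\<lambda>t. s * F (- t)) = F"
      using s sym_periodic_minus[OF F] by auto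
    moreover have "s * (F1 (- t) * - 1) = F1 t"
      using s sym_periodic_minus[OF F1] by auto
    ultimately show ?thesis by simp
  qed
  have shift: "(F has_real_derivative F1 t) (at t within {a + of_int k * (2 * T)..b + of_int k * (2 * T)})"
    if "(F has_real_derivative F1 (t - of_int k * (2 * T))) (at (t - of_int k * (2 * T)) within {a..b})"
    for a b t k
  proof -
    let ?c = "of_int k * (2 * T)"
    have im: "(\<lambda>x. x - ?c) ` {a + ?c..b + ?c} = {a..b}" by simp
    have "((\<lambda>x. x - ?c) has_real_derivative 1) (at t within {a + ?c..b + ?c})"
      by (auto intro!: derivative_eq_intros)
    with that have "((F \<circ> (\<lambda>x. x - ?c)) has_real_derivative F1 (t - ?c) * 1)
        (at t within {a + ?c..b + ?c})"
      by (intro DERIV_image_chain) (simp_all only: im)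
    moreover have "F \<circ> (\<lambda>x. x - ?c) = F" "F1 (t - ?c) = F1 t"
      using sym_periodic_add_int[OF F, of _ "- k"] sym_periodic_add_int[OF F1, of _ "- k"]
      by (auto simp: o_def)
    ultimately show ?thesis by simp
  qed
  obtain k r where r: "t = r + of_int k * (2 * T)" "- T \<le> r" "r < T"
    using periodic_reduce[OF \<open>0 < T\<close>] .
  have "(F has_real_derivative F1 r) (at r)"
  proof -
    consider "r = -T" | "- T < r" "r < 0" | "r = 0" | "0 < r" using r by linarith
    then show ?thesis
    proof cases
      case 1
      have "(F has_real_derivative F1 r) (at r within {-T..0})" using neg 1 \<open>0 < T\<close> by auto
      \<comment> \<open>The left-hand derivative at \<open>- T\<close> comes from the endpoint
        \<open>T\<close> of \<open>{0..T}\<close>, moved back by one period.\<close>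
      moreover have "(F has_real_derivative F1 r) (at r within {0 + of_int (-1) * (2 * T)..T + of_int (-1) * (2 * T)})"
      proof (rule shift)
        show "(F has_real_derivative F1 (r - of_int (- 1) * (2 * T))) (at (r - of_int (- 1) * (2 * T)) within {0..T})"
          by (rule der) (use 1 \<open>0 < T\<close> in auto)
      qed
      ultimately show ?thesis 
        using 1 \<open>0 < T\<close> by (intro DERIV_glue[of F _ r "- 2 * T" 0]) auto
    next
      case 2
      with neg[of r] r show ?thesis
        by (auto simp: at_within_Icc_at)
    next
      case 3
      with neg[of r] der[of r] \<open>0 < T\<close> show ?thesis
        by (intro DERIV_glue[of F _ r "- T" T]) auto
    next
      case 4
      with der[of r] r show ?thesis
        by (auto simp: at_within_Icc_at)
    qed
  qed
  then have "((\<lambda>x. F (x + of_int k * (2 * T))) has_real_derivative F1 t) (at r)"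
    by (simp add: r(1) sym_periodic_add_int[OF F] sym_periodic_add_int[OF F1])
  then show ?thesis by (simp add: DERIV_shift r(1))
qed

section \<open>Integrals under scaling and over several half periods\<close>

lemma integral_affine:
  fixes g :: "real \<Rightarrow> real"
  assumes "continuous_on UNIV g" "0 < s" "a \<le> b"
  shows "integral {a..b} (\<lambda>t. g (s * t + c)) = integral {s * a + c..s * b + c} g / s"
proof -
  have "(g has_integral integral {s * a + c..s * b + c} g) (cbox (s * a + c) (s * b + c))"
    using assms(1) by (auto intro!: integrable_integral integrable_continuous_real
        intro: continuous_on_subset)
  from has_integral_affinity[OF this, of s c]
  have "((\<lambda>t. g (s * t + c)) has_integral integral {s * a + c..s * b + c} g / s)
      ((\<lambda>x. x / s - c / s) ` {s * a + c..s * b + c})"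
    using assms(2) by simp
  also have "(\<lambda>x. x / s - c / s) ` {s * a + c..s * b + c} = {a..b}"
    using image_affinity_atLeastAtMost_div_diff[of s "c / s" "s * a + c" "s * b + c"] assms
    by (simp add: add_divide_distrib)
  finally show ?thesis by (rule integral_unique)
qed

lemma sym_periodic_integral:
  fixes g :: "real \<Rightarrow> real"
  assumes g: "sym_periodic 1 T g" and cont: "continuous_on UNIV g" and "0 < T"
  shows "integral {0..of_nat n * T} g = of_nat n * integral {0..T} g"
proof -
  have step: "integral {of_nat k * T..of_nat (Suc k) * T} g = integral {0..T} g" for k
  \<comment> \<open>Translation by the period skips two intervals, hence the induction in steps of
    two. The case of the second interval needs evenness.\<close>
  proof (induction k rule: induct_nat_012)
    case 0
    then show ?case by simp
  next
    case 1
    have "integral {of_nat (Suc 0) * T..of_nat (Suc (Suc 0)) * T} g = integral {-T..0} (\<lambda>t. g (1 * t + 2 * T))"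
      using assms by (subst integral_affine) auto
    also have "\<dots> = integral {-T..-0} (\<lambda>t. g (- t))"
      using g by (simp add: sym_periodic_def)
    also have "\<dots> = integral {0..T} g" by (rule Henstock_Kurzweil_Integration.integral_reflect_real)
    finally show ?case .
  next
    case (ge2 k)
    have "integral {of_nat (Suc (Suc k)) * T..of_nat (Suc (Suc (Suc k))) * T} g =
        integral {of_nat k * T..of_nat (Suc k) * T} (\<lambda>t. g (1 * t + 2 * T))"
      using assms by (subst integral_affine) (auto simp: algebra_simps)
    also have "\<dots> = integral {of_nat k * T..of_nat (Suc k) * T} g"
      using g by (simp add: sym_periodic_def)
    finally show ?case using ge2 by simp
  qed
  show ?thesis
  proof (induction n)
    case (Suc n)
    have "integral {0..of_nat n * T} g + integral {of_nat n * T..of_nat (Suc n) * T} g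
        = integral {0..of_nat (Suc n) * T} g"
      using cont \<open>0 < T\<close> by (intro Henstock_Kurzweil_Integration.integral_combine) (auto simp: field_simps
          intro!: integrable_continuous_real intro: continuous_on_subset)
    with Suc step[of n] show ?case by (simp add: algebra_simps)
  qed simp
qed

subsection \<open>Eigenfunctions as periodic solutions of the first-order system\<close>

text \<open>\<open>W\<close> stands for \<open>signed_pow p U''\<close>, and \<open>p / (p - 1)\<close> is the conjugate exponent.\<close>

definition periodic_solution where
  "periodic_solution p q l T U U1 W W1 \<longleftrightarrow>
    sym_periodic (- 1) T U \<and> sym_periodic 1 T U1 \<and> sym_periodic (- 1) T W \<and> sym_periodic 1 T W1 \<and>
    (\<forall>t. (U has_real_derivative U1 t) (at t) \<and>
         (U1 has_real_derivative signed_pow (p / (p - 1)) (W t)) (at t) \<and>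
         (W has_real_derivative W1 t) (at t) \<and>
         (W1 has_real_derivative l * signed_pow q (U t)) (at t))"

lemma conjugate_exponent:
  fixes p :: real
  assumes "1 < p"
  shows "1 < p / (p - 1)" "(p - 1) * (p / (p - 1) - 1) = 1" "(p / (p - 1) - 1) * (p - 1) = 1"
  using assms by (auto simp: field_simps)

lemma deriv_on_eqI:
  assumes "(f has_real_derivative D) (at t within {a..b})" "t \<in> {a..b}" "a < b"
  shows "deriv_on {a..b} f t = D"
  using assms unfolding deriv_on_def has_real_derivative_iff_has_vector_derivative
  by (intro vector_derivative_within_closed_interval)

lemma C1_on_has_real_derivative:
  assumes "C1_on S f" "t \<in> S"
  shows "(f has_real_derivative deriv_on S f t) (at t within S)"
  using assms unfolding C1_on_def deriv_on_def has_real_derivative_iff_has_vector_derivative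
  by (auto simp: differentiable_on_def vector_derivative_works[symmetric])

lemma C1_onI:
  assumes der: "\<And>t. t \<in> {a..b} \<Longrightarrow> (f has_real_derivative f' t) (at t within {a..b})"
    and cont: "continuous_on {a..b} f'" and "a < b"
  shows "C1_on {a..b} f" "t \<in> {a..b} \<Longrightarrow> deriv_on {a..b} f t = f' t"
proof -
  show eq: "deriv_on {a..b} f t = f' t" if "t \<in> {a..b}" for t
    using der[OF that] that \<open>a < b\<close> by (rule deriv_on_eqI)
  have "continuous_on {a..b} (deriv_on {a..b} f)"
    using cont by (rule continuous_on_eq) (simp add: eq)
  moreover have "f differentiable_on {a..b}"
    using der unfolding differentiable_on_def
    unfolding real_differentiable_def by blast
  ultimately show "C1_on {a..b} f" by (simp add: C1_on_def)
qed

lemma sym_periodic_odd_comp: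
  assumes "sym_periodic (- 1) T F" "\<And>x. g (- x) = - g x"
  shows "sym_periodic (- 1) T (\<lambda>t. g (F t))"
  using assms by (simp add: sym_periodic_def)

lemma periodic_solution_eigenpair:
  assumes sol: "periodic_solution p q l T U U1 W W1" and "0 < T" "1 < p" "1 < q" "0 < l"
    and nz: "\<exists>t\<in>{0..T}. U t \<noteq> 0" and f: "\<And>t. t \<in> {0..T} \<Longrightarrow> f t = U t"
  shows "eigenpair p q T f l"
    and "t \<in> {0..T} \<Longrightarrow> deriv_on {0..T} f t = U1 t"
    and "t \<in> {0..T} \<Longrightarrow> deriv_on {0..T} (deriv_on {0..T} f) t = signed_pow (p / (p - 1)) (W t)"
proof -
  define I where "I = {0..T}"
  note psol = sol[unfolded periodic_solution_def]
  have der: "(U has_real_derivative U1 t) (at t within I)"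
       "(U1 has_real_derivative signed_pow (p / (p - 1)) (W t)) (at t within I)"
       "(W has_real_derivative W1 t) (at t within I)"
       "(W1 has_real_derivative l * signed_pow q (U t)) (at t within I)" for t
    using psol by (auto intro: DERIV_subset)
  \<comment> \<open>Each \<open>deriv_on\<close> agrees with a globally differentiable function only
    on \<open>I\<close>. This form transfers differentiability under agreement on \<open>I\<close>,
    so that the four nested derivatives can be identified one after the other.\<close>
  have C1: "C1_on I g \<and> (\<forall>t\<in>I. deriv_on I g t = h' t)"
    if "\<And>t. (h has_real_derivative h' t) (at t within I)" "\<And>t. t \<in> I \<Longrightarrow> g t = h t"
      "continuous_on I h'" for g h h'
  proof -
    have "(g has_real_derivative h' t) (at t within I)" if "t \<in> I" for t
      using \<open>\<And>t. (h has_real_derivative h' t) (at t within I)\<close>[of t]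
      by (rule has_field_derivative_transform_within[of _ _ _ _ 1])
        (use that \<open>\<And>t. t \<in> I \<Longrightarrow> g t = h t\<close> in auto)
    then show ?thesis
      using C1_onI[of 0 T g h'] that \<open>0 < T\<close> by (auto simp: I_def)
  qed
  have cont: "continuous_on I U" "continuous_on I U1" "continuous_on I W" "continuous_on I W1"
    using der by (auto intro!: DERIV_continuous_on)
  have p: "1 < p / (p - 1)" using conjugate_exponent[OF \<open>1 < p\<close>] by simp
  have 1: "C1_on I f" and e1: "\<And>t. t \<in> I \<Longrightarrow> deriv_on I f t = U1 t"
    using C1[OF der(1) _ cont(2), of f] f by (auto simp: I_def)
  have 2: "C1_on I (deriv_on I f)"
    and e2: "\<And>t. t \<in> I \<Longrightarrow> deriv_on I (deriv_on I f) t = signed_pow (p / (p - 1)) (W t)"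
    using C1[OF der(2) e1 continuous_on_signed_pow[OF p cont(3)]] by auto
  define w where "w = (\<lambda>t. signed_pow p (deriv_on I (deriv_on I f) t))"
  have w: "w t = W t" if "t \<in> I" for t
    unfolding w_def e2[OF that] by (rule signed_pow_signed_pow) (use conjugate_exponent[OF \<open>1 < p\<close>] in simp)
  have 3: "C1_on I w" and e3: "\<And>t. t \<in> I \<Longrightarrow> deriv_on I w t = W1 t"
    using C1[OF der(3) w cont(4)] by auto
  have 4: "C1_on I (deriv_on I w)"
    and e4: "\<And>t. t \<in> I \<Longrightarrow> deriv_on I (deriv_on I w) t = l * signed_pow q (U t)"
    using C1[OF der(4) e3 continuous_on_mult_left[OF continuous_on_signed_pow[OF \<open>1 < q\<close> cont(1)]]]
    by auto
  have zero: "U 0 = 0" "U T = 0" "W 0 = 0" "W T = 0"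
    using sym_periodic_odd_zero[of T U 0] sym_periodic_odd_zero[of T U 1]
      sym_periodic_odd_zero[of T W 0] sym_periodic_odd_zero[of T W 1] psol by auto
  have "0 \<in> I" "T \<in> I" using \<open>0 < T\<close> by (auto simp: I_def)
  show "eigenpair p q T f l"
    unfolding eigenpair_def I_def[symmetric] Let_def w_def[symmetric]
    using 1 2 3 4 e4 e2 zero f \<open>0 \<in> I\<close> \<open>T \<in> I\<close> nz \<open>0 < l\<close> by (auto simp: I_def)
  show "t \<in> {0..T} \<Longrightarrow> deriv_on {0..T} f t = U1 t"
    and "t \<in> {0..T} \<Longrightarrow> deriv_on {0..T} (deriv_on {0..T} f) t = signed_pow (p / (p - 1)) (W t)"
    using e1 e2 by (auto simp: I_def)
qed

text \<open>The values at both ends let \<open>f\<close> and \<open>w\<close> extend oddly and their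
  derivatives evenly. The nonlinearities are odd functions, so the equations survive reflection with
  matching parities.\<close>

lemma periodic_solution_extend:
  assumes "0 < T"
    and der: "\<And>t. t \<in> {0..T} \<Longrightarrow> (f has_real_derivative f1 t) (at t within {0..T})"
      "\<And>t. t \<in> {0..T} \<Longrightarrow> (f1 has_real_derivative signed_pow (p / (p - 1)) (w t)) (at t within {0..T})"
      "\<And>t. t \<in> {0..T} \<Longrightarrow> (w has_real_derivative w1 t) (at t within {0..T})"
      "\<And>t. t \<in> {0..T} \<Longrightarrow> (w1 has_real_derivative l * signed_pow q (f t)) (at t within {0..T})"
    and zero: "f 0 = 0" "f T = 0" "w 0 = 0" "w T = 0"
  obtains U U1 W W1 where "periodic_solution p q l T U U1 W W1"
    "\<And>t. t \<in> {0..T} \<Longrightarrow> U t = f t" "\<And>t. t \<in> {0..T} \<Longrightarrow> W t = w t"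
proof -
  obtain U where U: "sym_periodic (- 1) T U" "\<And>t. t \<in> {0..T} \<Longrightarrow> U t = f t"
    using sym_periodic_exists[of T "- 1" f] zero \<open>0 < T\<close> by auto
  obtain U1 where U1: "sym_periodic 1 T U1" "\<And>t. t \<in> {0..T} \<Longrightarrow> U1 t = f1 t"
    using sym_periodic_exists[of T 1 f1] zero \<open>0 < T\<close> by auto
  obtain W where W: "sym_periodic (- 1) T W" "\<And>t. t \<in> {0..T} \<Longrightarrow> W t = w t"
    using sym_periodic_exists[of T "- 1" w] zero \<open>0 < T\<close> by auto
  obtain W1 where W1: "sym_periodic 1 T W1" "\<And>t. t \<in> {0..T} \<Longrightarrow> W1 t = w1 t"
    using sym_periodic_exists[of T 1 w1] zero \<open>0 < T\<close> by auto
  have lift: "(F has_real_derivative F1 t) (at t)"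
    if "sym_periodic \<sigma> T F" "sym_periodic (- \<sigma>) T F1" "\<sigma> = 1 \<or> \<sigma> = - 1"
      and der: "\<And>t. t \<in> {0..T} \<Longrightarrow> (g has_real_derivative g1 t) (at t within {0..T})"
      and eq: "\<And>t. t \<in> {0..T} \<Longrightarrow> F t = g t" "\<And>t. t \<in> {0..T} \<Longrightarrow> F1 t = g1 t" for \<sigma> F F1 g g1 t
  proof (rule sym_periodic_has_derivative[OF that(1,2) \<open>0 < T\<close> that(3)])
    fix t assume t: "t \<in> {0..T}"
    show "(F has_real_derivative F1 t) (at t within {0..T})"
      unfolding eq(2)[OF t]
      by (rule has_field_derivative_transform_within[of g _ _ _ 1])
        (use der[of t] t eq(1) in auto)
  qed
  have "(U has_real_derivative U1 t) (at t)" for t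
    by (rule lift[OF U(1) _ _ der(1)]) (use U U1 in auto)
  moreover have "(U1 has_real_derivative signed_pow (p / (p - 1)) (W t)) (at t)" for t
    by (rule lift[OF U1(1) _ _ der(2)])
      (use U1 W sym_periodic_odd_comp[OF W(1), of "signed_pow _"] in auto)
  moreover have "(W has_real_derivative W1 t) (at t)" for t
    by (rule lift[OF W(1) _ _ der(3)]) (use W W1 in auto)
  moreover have "(W1 has_real_derivative l * signed_pow q (U t)) (at t)" for t
    by (rule lift[OF W1(1) _ _ der(4)])
      (use W1 U sym_periodic_odd_comp[OF U(1), of "\<lambda>x. l * signed_pow q x"] in auto)
  ultimately have "periodic_solution p q l T U U1 W W1"
    using U(1) U1(1) W(1) W1(1) by (simp add: periodic_solution_def)
  from that[OF this U(2) W(2)] show ?thesis by simp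
qed

lemma eigenpair_periodic_solution:
  assumes "eigenpair p q T f l" "0 < T" "1 < p"
  obtains U U1 W W1 where "periodic_solution p q l T U U1 W W1" "\<And>t. t \<in> {0..T} \<Longrightarrow> U t = f t"
proof -
  define I where "I = {0..T}"
  define f1 where "f1 = deriv_on I f"
  define f2 where "f2 = deriv_on I f1"
  define w where "w = (\<lambda>t. signed_pow p (f2 t))"
  define w1 where "w1 = deriv_on I w"
  have *: "C1_on I f" "C1_on I f1" "C1_on I w" "C1_on I w1"
      "\<And>t. t \<in> I \<Longrightarrow> deriv_on I w1 t = l * signed_pow q (f t)"
      "f 0 = 0" "f T = 0" "f2 0 = 0" "f2 T = 0"
    using assms(1) by (auto simp: eigenpair_def Let_def I_def f1_def f2_def w_def w1_def)
  have w0: "w 0 = 0" "w T = 0" using * by (auto simp: w_def)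
  have f2: "f2 t = signed_pow (p / (p - 1)) (w t)" for t
    unfolding w_def by (rule signed_pow_signed_pow[symmetric]) (use conjugate_exponent[OF \<open>1 < p\<close>] in simp)
  have der: "(f has_real_derivative f1 t) (at t within I)"
       "(f1 has_real_derivative signed_pow (p / (p - 1)) (w t)) (at t within I)"
       "(w has_real_derivative w1 t) (at t within I)"
       "(w1 has_real_derivative l * signed_pow q (f t)) (at t within I)" if "t \<in> I" for t
    using C1_on_has_real_derivative[OF *(1) that] C1_on_has_real_derivative[OF *(2) that]
      C1_on_has_real_derivative[OF *(3) that] C1_on_has_real_derivative[OF *(4) that]
    by (auto simp: f1_def f2_def[symmetric] w1_def *(5)[OF that, unfolded w1_def] f2[symmetric])
      (auto simp: f1_def f2_def)
  from periodic_solution_extend[OF \<open>0 < T\<close> der[unfolded I_def] *(6,7) w0] that show ?thesis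
    by metis
qed

lemma periodic_solution_continuous:
  assumes "periodic_solution p q l T U U1 W W1"
  shows "continuous_on S U" "continuous_on S U1" "continuous_on S W" "continuous_on S W1"
  using assms unfolding periodic_solution_def
  by (auto intro!: DERIV_continuous_on intro: DERIV_subset)

text \<open>Since \<open>u'' = signed_pow (p / (p - 1)) W\<close> and
  \<open>p * (p / (p - 1) - 1) = p / (p - 1)\<close>, the normalization becomes an integral of
  \<open>W\<close>, and the outer root disappears because the value is 1. Nontriviality is absorbed
  by the positive slope.\<close>

lemma spectral_couple_iff:
  assumes sol: "periodic_solution p q l T U U1 W W1" and "0 < T" "1 < p" "1 < q"
    and f: "\<And>t. t \<in> {0..T} \<Longrightarrow> f t = U t"
  shows "spectral_couple p q T f l \<longleftrightarrow>
    0 < l \<and> 0 < U1 0 \<and> integral {0..T} (\<lambda>t. \<bar>W t\<bar> powr (p / (p - 1))) = 1"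
proof -
  have nz: "\<exists>t\<in>{0..T}. U t \<noteq> 0" if "0 < U1 0"
  proof -
    have "(U has_real_derivative U1 0) (at 0)" using sol by (simp add: periodic_solution_def)
    from DERIV_pos_inc_right[OF this that] obtain d where d: "0 < d" "\<And>h. 0 < h \<Longrightarrow> h < d \<Longrightarrow> U 0 < U h"
      by auto
    have "U 0 = 0" using sol sym_periodic_odd_zero[of T U 0] by (simp add: periodic_solution_def)
    moreover have "min (d / 2) T < d" using d(1) by auto
    ultimately have "U (min (d / 2) T) \<noteq> 0" "min (d / 2) T \<in> {0..T}"
      using d(2)[of "min (d / 2) T"] d(1) \<open>0 < T\<close> by auto
    then show ?thesis by blast
  qed
  have norm: "Lp_norm_on p {0..T} (deriv_on {0..T} (deriv_on {0..T} f)) =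
      integral {0..T} (\<lambda>t. \<bar>W t\<bar> powr (p / (p - 1))) powr (1 / p)" 
    if "0 < l" "\<exists>t\<in>{0..T}. U t \<noteq> 0"
  proof -
    have "(LINT t:{0..T}|lborel. \<bar>deriv_on {0..T} (deriv_on {0..T} f) t\<bar> powr p) =
      (LINT t:{0..T}|lborel. \<bar>W t\<bar> powr (p / (p - 1)))"
    proof (rule set_lebesgue_integral_cong)
      show "\<forall>t. t \<in> {0..T} \<longrightarrow> \<bar>deriv_on {0..T} (deriv_on {0..T} f) t\<bar> powr p = \<bar>W t\<bar> powr (p / (p - 1))"
        using periodic_solution_eigenpair(3)[OF sol \<open>0 < T\<close> \<open>1 < p\<close> \<open>1 < q\<close> that f] \<open>1 < p\<close>
        by (auto simp: abs_signed_pow powr_powr field_simps)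
    qed auto
    also have "\<dots> = integral {0..T} (\<lambda>t. \<bar>W t\<bar> powr (p / (p - 1)))"
      using periodic_solution_continuous[OF sol] \<open>1 < p\<close>
      by (intro set_borel_integral_eq_integral borel_integrable_atLeastAtMost' continuous_intros
          continuous_on_powr') auto
    finally show ?thesis by (simp add: Lp_norm_on_def)
  qed
  have eq1: "x powr (1 / p) = 1 \<longleftrightarrow> x = 1" if "0 \<le> x" for x
    using that \<open>1 < p\<close> powr_powr[of x "1/p" p] by (cases "x powr (1/p) = 1") auto
  \<comment> \<open>In the nonintegrable case the integral has the default value 0.\<close>
  have ge0: "0 \<le> integral {0..T} (\<lambda>t. \<bar>W t\<bar> powr (p / (p - 1)))"
    by (cases "(\<lambda>t. \<bar>W t\<bar> powr (p / (p - 1))) integrable_on {0..T}")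
      (auto intro: integral_nonneg simp: not_integrable_integral)
  show ?thesis
  proof
    assume sc: "spectral_couple p q T f l"
    then have "0 < l" "\<exists>t\<in>{0..T}. U t \<noteq> 0"
      using f by (auto simp: spectral_couple_def eigenpair_def Let_def)
    with sc norm periodic_solution_eigenpair(2)[OF sol \<open>0 < T\<close> \<open>1 < p\<close> \<open>1 < q\<close> _ _ f, of 0] \<open>0 < T\<close>
    show "0 < l \<and> 0 < U1 0 \<and> integral {0..T} (\<lambda>t. \<bar>W t\<bar> powr (p / (p - 1))) = 1"
      by (auto simp: spectral_couple_def eq1 ge0)
  next
    assume r: "0 < l \<and> 0 < U1 0 \<and> integral {0..T} (\<lambda>t. \<bar>W t\<bar> powr (p / (p - 1))) = 1"
    with norm nz periodic_solution_eigenpair(1)[OF sol \<open>0 < T\<close> \<open>1 < p\<close> \<open>1 < q\<close> _ _ f]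
      periodic_solution_eigenpair(2)[OF sol \<open>0 < T\<close> \<open>1 < p\<close> \<open>1 < q\<close> _ _ f, of 0] \<open>0 < T\<close>
    show "spectral_couple p q T f l"
      by (auto simp: spectral_couple_def)
  qed
qed

lemma spectral_couple_periodic_solution:
  assumes "spectral_couple p q T f l" "0 < T" "1 < p" "1 < q"
  obtains U U1 W W1 where "periodic_solution p q l T U U1 W W1" "\<And>t. t \<in> {0..T} \<Longrightarrow> f t = U t"
    "0 < l" "0 < U1 0" "integral {0..T} (\<lambda>t. \<bar>W t\<bar> powr (p / (p - 1))) = 1"
proof -
  from assms(1) have "eigenpair p q T f l" by (simp add: spectral_couple_def)
  then obtain U U1 W W1 where "periodic_solution p q l T U U1 W W1" "\<And>t. t \<in> {0..T} \<Longrightarrow> U t = f t"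
    using eigenpair_periodic_solution assms(2,3) by blast
  with spectral_couple_iff[of p q l T U U1 W W1 f] assms that show ?thesis by auto
qed

text \<open>Amplitude \<open>c\<close> and frequency \<open>s\<close> multiply \<open>U''\<close> by
  \<open>c * s\<^sup>2\<close>, hence \<open>W\<close> by its power \<open>p - 1\<close>, which is
  \<open>d\<close>. The new eigenvalue is read off from \<open>W''\<close>, after pulling
  \<open>c\<close> out of \<open>signed_pow q\<close>.\<close>

lemma periodic_solution_scale:
  assumes sol: "periodic_solution p q l T U U1 W W1" and "0 < c" "0 < s" "1 < p"
  defines "d \<equiv> (c * s\<^sup>2) powr (p - 1)"
  shows "periodic_solution p q (d * s\<^sup>2 * l / c powr (q - 1)) (T / s)
    (\<lambda>t. c * U (s * t)) (\<lambda>t. c * s * U1 (s * t)) (\<lambda>t. d * W (s * t)) (\<lambda>t. d * s * W1 (s * t))"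
proof -
  have "0 < d" using assms by (simp add: d_def)
  have d: "d powr (p / (p - 1) - 1) = c * s\<^sup>2"
    unfolding d_def using conjugate_exponent[OF \<open>1 < p\<close>] assms by (simp add: powr_powr)
  have chain: "((\<lambda>t. a * F (s * t)) has_real_derivative D) (at t)"
    if "(F has_real_derivative D') (at (s * t))" "D = a * s * D'" for F D D' a t
  proof -
    have "((\<lambda>t. s * t) has_real_derivative s) (at t)"
      by (auto intro!: derivative_eq_intros)
    from DERIV_cmult[OF DERIV_chain'[OF this that(1)], of a] show ?thesis
      by (simp add: that(2) algebra_simps)
  qed
  show ?thesis
    unfolding periodic_solution_def
  proof (intro conjI allI)
    fix t
    show "((\<lambda>t. c * U (s * t)) has_real_derivative c * s * U1 (s * t)) (at t)"
      by (rule chain[of U "U1 (s * t)"]) (use sol in \<open>auto simp: periodic_solution_def\<close>)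
    show "((\<lambda>t. d * W (s * t)) has_real_derivative d * s * W1 (s * t)) (at t)"
      by (rule chain[of W "W1 (s * t)"]) (use sol in \<open>auto simp: periodic_solution_def\<close>)
    show "((\<lambda>t. c * s * U1 (s * t)) has_real_derivative signed_pow (p / (p - 1)) (d * W (s * t))) (at t)"
      by (rule chain[of U1 "signed_pow (p / (p - 1)) (W (s * t))"])
        (use sol \<open>0 < d\<close> in \<open>auto simp: periodic_solution_def signed_pow_scale d power2_eq_square\<close>)
    show "((\<lambda>t. d * s * W1 (s * t)) has_real_derivative
        d * s\<^sup>2 * l / c powr (q - 1) * signed_pow q (c * U (s * t))) (at t)"
      by (rule chain[of W1 "l * signed_pow q (U (s * t))"])
        (use sol \<open>0 < c\<close> in \<open>auto simp: periodic_solution_def signed_pow_scale power2_eq_square\<close>)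
  qed (use sol \<open>0 < s\<close> in \<open>auto simp: periodic_solution_def intro!: sym_periodic_scale\<close>)
qed

text \<open>The source of the higher eigenfunctions: the same solution, seen on an interval of
  \<open>n\<close> half periods, has \<open>n\<close> arches.\<close>

lemma periodic_solution_mult_nat:
  assumes "periodic_solution p q l T U U1 W W1"
  shows "periodic_solution p q l (of_nat n * T) U U1 W W1"
  using assms sym_periodic_mult_nat unfolding periodic_solution_def by blast

subsection \<open>Comparison and uniqueness\<close>

text \<open>As long as \<open>e\<close> is nonnegative, \<open>d\<close> is convex with zero initial
  data, hence nonnegative, and this in turn makes \<open>e\<close> convex. So the slope of
  \<open>e\<close> cannot drop below its positive initial value, and the two sign conditions sustain
  each other forever.\<close>

lemma cooperative_growth:
  fixes d d1 d2 e e1 e2 :: "real \<Rightarrow> real"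
  assumes der: "\<And>t. (d has_real_derivative d1 t) (at t)" "\<And>t. (d1 has_real_derivative d2 t) (at t)"
      "\<And>t. (e has_real_derivative e1 t) (at t)" "\<And>t. (e1 has_real_derivative e2 t) (at t)"
    and init: "d 0 = 0" "d1 0 = 0" "e 0 = 0" "0 < e1 0"
    and sign: "\<And>t. 0 \<le> e t \<Longrightarrow> 0 \<le> d2 t" "\<And>t. 0 \<le> d t \<Longrightarrow> 0 \<le> e2 t"
    and "0 \<le> t"
  shows "e1 0 * t \<le> e t"
proof -
  have mono: "f 0 \<le> f x" if "\<And>t. (f has_real_derivative f1 t) (at t)" "\<And>t. 0 \<le> t \<Longrightarrow> t \<le> x \<Longrightarrow> 0 \<le> f1 t"
    "0 \<le> x" for f f1 :: "real \<Rightarrow> real" and x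
    using that by (intro DERIV_nonneg_imp_nondecreasing[of 0 x f]) blast+
  have chain: "e1 0 \<le> e1 x" if "0 \<le> x" "\<And>t. 0 \<le> t \<Longrightarrow> t \<le> x \<Longrightarrow> 0 \<le> e t" for x
  proof -
    have "0 \<le> d1 t" if "0 \<le> t" "t \<le> x" for t
      using mono[OF der(2), of t] that \<open>\<And>t. 0 \<le> t \<Longrightarrow> t \<le> x \<Longrightarrow> 0 \<le> e t\<close> sign(1) init by simp
    then have "0 \<le> d t" if "0 \<le> t" "t \<le> x" for t
      using mono[OF der(1), of t] that init by simp
    then show ?thesis using mono[OF der(4) _ \<open>0 \<le> x\<close>] sign(2) by simp
  qed
  have e1: "0 < e1 x" if "0 \<le> x" for x
  proof (rule ccontr)
    assume "\<not> 0 < e1 x"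
    define A where "A = {t. 0 \<le> t \<and> e1 t \<le> 0}"
    have A: "A \<noteq> {}" "bdd_below A" using that \<open>\<not> 0 < e1 x\<close> by (auto simp: A_def)
    have "continuous_on UNIV e1" using der(4) by (auto intro!: DERIV_continuous_on)
    then have "closed A" unfolding A_def
      by (intro closed_Collect_conj closed_Collect_le continuous_intros)
    with A have "Inf A \<in> A" by (intro closed_contains_Inf)
    \<comment> \<open>The first time at which the slope of \<open>e\<close> would stop being
      positive. Up to then \<open>e\<close> increases, so it is nonnegative, and convexity yields
      \<open>e1 0 \<le> e1 s\<close>, a contradiction.\<close>
    define s where "s = Inf A"
    have s: "0 \<le> s" "e1 s \<le> 0" using \<open>Inf A \<in> A\<close> by (auto simp: A_def s_def)
    have below: "0 < e1 t" if "0 \<le> t" "t < s" for t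
    proof (rule ccontr)
      assume "\<not> 0 < e1 t"
      then have "t \<in> A" using that by (simp add: A_def)
      from cInf_lower[OF this A(2)] that show False by (simp add: s_def)
    qed
    have "0 \<le> e t" if "0 \<le> t" "t \<le> s" for t
    proof (cases "t = 0")
      case False
      have "e 0 < e t"
      proof (rule DERIV_pos_imp_increasing_open[where f = e])
        show "0 < t" using that False by simp
        show "\<exists>y. (e has_real_derivative y) (at x) \<and> 0 < y" if "0 < x" "x < t" for x
          using der(3) below[of x] that \<open>t \<le> s\<close> by auto
        show "continuous_on {0..t} e" using der(3) by (auto intro!: DERIV_continuous_on intro: DERIV_subset)
      qed
      then show ?thesis using init by simp
    qed (use init in simp)
    from chain[OF s(1) this] s init show False by simp
  qed
  have "0 \<le> e x" if "0 \<le> x" for x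
    using mono[OF der(3), of x] e1 that init by (simp add: less_imp_le)
  then have "e1 0 \<le> e1 x" if "0 \<le> x" for x
    using chain[of x] that by simp
  then have "(\<lambda>t. e t - e1 0 * t) 0 \<le> (\<lambda>t. e t - e1 0 * t) t"
    using der(3) \<open>0 \<le> t\<close>
    by (intro mono[of "\<lambda>t. e t - e1 0 * t" "\<lambda>t. e1 t - e1 0"]) (auto intro!: derivative_eq_intros)
  then show ?thesis using init by simp
qed

lemma sym_periodic_bounded:
  assumes F: "sym_periodic s T F" and "0 < T" and cont: "continuous_on UNIV F"
  obtains B where "\<And>t. \<bar>F t\<bar> \<le> B"
proof -
  have "compact (F ` {-T..T})"
    using cont by (intro compact_continuous_image) (auto intro: continuous_on_subset)
  then obtain B where B: "\<And>t. t \<in> {-T..T} \<Longrightarrow> \<bar>F t\<bar> \<le> B"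
    by (force dest!: compact_imp_bounded simp: bounded_real)
  have "\<bar>F t\<bar> \<le> B" for t
  proof -
    obtain k r where "t = r + of_int k * (2 * T)" "- T \<le> r" "r < T"
      using periodic_reduce[OF \<open>0 < T\<close>] .
    then show ?thesis using B[of r] sym_periodic_add_int[OF F, of r k] by simp
  qed
  with that show ?thesis by blast
qed

lemma periodic_solution_at_0:
  assumes "periodic_solution p q l T U U1 W W1"
  shows "U 0 = 0" "W 0 = 0"
  using assms sym_periodic_odd_zero[of T U 0] sym_periodic_odd_zero[of T W 0]
  by (auto simp: periodic_solution_def)

lemma periodic_solution_bounded:
  assumes "periodic_solution p q l T U U1 W W1" "0 < T"
  obtains B where "\<And>t. \<bar>W t\<bar> \<le> B"
  using sym_periodic_bounded[of _ T W] assms periodic_solution_continuous(3)[OF assms(1)]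
  unfolding periodic_solution_def by metis

text \<open>The half periods \<open>T\<close> and \<open>S\<close> enter only through boundedness
  and may differ. This matters because the comparison is made with a rescaled arch whose half period
  is shorter than the interval in general.\<close>

lemma periodic_solution_slope_le:
  assumes U: "periodic_solution p q l T U U1 W W1" and V: "periodic_solution p q l S V V1 Z Z1"
    and pos: "0 < T" "0 < S" "0 < l" "1 < p" "1 < q" and eq: "U1 0 = V1 0"
  shows "W1 0 \<le> Z1 0"
proof (rule ccontr)
  assume *: "\<not> W1 0 \<le> Z1 0"
  have p: "1 < p / (p - 1)" using conjugate_exponent \<open>1 < p\<close> by blast
  have grow: "(W1 0 - Z1 0) * t \<le> W t - Z t" if "0 \<le> t" for t
  proof (rule cooperative_growth)
    show "((\<lambda>t. U t - V t) has_real_derivative U1 t - V1 t) (at t)"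
      "((\<lambda>t. U1 t - V1 t) has_real_derivative
          signed_pow (p / (p - 1)) (W t) - signed_pow (p / (p - 1)) (Z t)) (at t)"
      "((\<lambda>t. W t - Z t) has_real_derivative W1 t - Z1 t) (at t)"
      "((\<lambda>t. W1 t - Z1 t) has_real_derivative l * signed_pow q (U t) - l * signed_pow q (V t)) (at t)" for t
      using U V by (auto simp: periodic_solution_def intro!: derivative_intros)
    show "0 \<le> signed_pow (p / (p - 1)) (W t) - signed_pow (p / (p - 1)) (Z t)" if "0 \<le> W t - Z t" for t
      using mono_signed_pow[OF p, of "Z t" "W t"] that by simp
    show "0 \<le> l * signed_pow q (U t) - l * signed_pow q (V t)" if "0 \<le> U t - V t" for t
      using mono_signed_pow[OF \<open>1 < q\<close>, of "V t" "U t"] that \<open>0 < l\<close> by simp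
  qed (use that * eq periodic_solution_at_0[OF U] periodic_solution_at_0[OF V] in auto)
  obtain B where B: "\<And>t. \<bar>W t\<bar> \<le> B" using periodic_solution_bounded[OF U pos(1)] by blast
  obtain C where C: "\<And>t. \<bar>Z t\<bar> \<le> C" using periodic_solution_bounded[OF V pos(2)] by blast
  \<comment> \<open>At this time the linear lower bound for \<open>W t - Z t\<close> equals
    \<open>B + C + 1\<close>, beyond the upper bound \<open>B + C\<close>.\<close>
  define t where "t = (B + C + 1) / (W1 0 - Z1 0)"
  have BC: "0 \<le> B" "0 \<le> C" using B[of 0] C[of 0] by auto
  have "(W1 0 - Z1 0) * t = B + C + 1" "0 \<le> t" using * BC by (auto simp: t_def)
  with grow[of t] B[of t] C[of t] show False by linarith
qed

lemma periodic_solution_slope_unique: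
  assumes "periodic_solution p q l T U U1 W W1" "periodic_solution p q l S V V1 Z Z1"
    "0 < T" "0 < S" "0 < l" "1 < p" "1 < q" "U1 0 = V1 0"
  shows "W1 0 = Z1 0"
  using periodic_solution_slope_le[of p q l T U U1 W W1 S V V1 Z Z1]
    periodic_solution_slope_le[of p q l S V V1 Z Z1 T U U1 W W1] assms by simp

section \<open>Unique continuation past simple zeros\<close>

lemma abs_diff_le_deriv:
  fixes f g :: "real \<Rightarrow> real"
  assumes "\<And>t. (f has_real_derivative f1 t) (at t)" "\<And>t. (g has_real_derivative g1 t) (at t)"
    and "f a = g a" "\<And>t. t \<in> {a..b} \<Longrightarrow> \<bar>f1 t - g1 t\<bar> \<le> D" "t \<in> {a..b}"
  shows "\<bar>f t - g t\<bar> \<le> D * (t - a)"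
proof -
  have "norm ((f t - g t) - (f a - g a)) \<le> D * norm (t - a)"
    using assms by (intro field_differentiable_bound[of "{a..b}" "\<lambda>t. f t - g t" "\<lambda>t. f1 t - g1 t"])
      (auto intro!: derivative_intros intro: DERIV_subset)
  with assms(3,5) show ?thesis by simp
qed

text \<open>The right-hand sides need not be Lipschitz where they vanish, but at a simple zero
  the loss in the Lipschitz constant is compensated by the smallness of the functions.\<close>

lemma signed_pow_diff_bound:
  fixes u v :: "real \<Rightarrow> real"
  assumes u: "\<And>t. (u has_real_derivative u1 t) (at t)" and v: "\<And>t. (v has_real_derivative v1 t) (at t)"
    and eq: "u a = v a" "u1 a = v1 a" and nz: "v a \<noteq> 0 \<or> v1 a \<noteq> 0" and r: "1 < r"
  obtains d K where "0 < d" "0 < K"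
    "\<And>h D t. h < d \<Longrightarrow> (\<And>t. t \<in> {a..a + h} \<Longrightarrow> \<bar>u1 t - v1 t\<bar> \<le> D) \<Longrightarrow> t \<in> {a..a + h} \<Longrightarrow>
      \<bar>signed_pow r (u t) - signed_pow r (v t)\<bar> \<le> K * D"
proof (cases "v a = 0")
  case False
  obtain d L where dL: "0 < d" "0 < L"
    "\<And>x y. \<bar>x - v a\<bar> < d \<Longrightarrow> \<bar>y - v a\<bar> < d \<Longrightarrow> \<bar>signed_pow r x - signed_pow r y\<bar> \<le> L * \<bar>x - y\<bar>"
    using signed_pow_locally_Lipschitz[OF False] by blast
  have near: "\<exists>e>0. \<forall>t. \<bar>t - a\<bar> < e \<longrightarrow> \<bar>f t - f a\<bar> < d"
    if "\<And>t. (f has_real_derivative f1 t) (at t)" for f f1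
    using DERIV_isCont[OF that[of a]] \<open>0 < d\<close>
    unfolding continuous_at_eps_delta dist_real_def by blast
  obtain e1 where e1: "0 < e1" "\<And>t. \<bar>t - a\<bar> < e1 \<Longrightarrow> \<bar>u t - u a\<bar> < d" using near[OF u] by blast
  obtain e2 where e2: "0 < e2" "\<And>t. \<bar>t - a\<bar> < e2 \<Longrightarrow> \<bar>v t - v a\<bar> < d" using near[OF v] by blast
  show ?thesis
  proof (rule that[of "min 1 (min e1 e2)" L])
    fix h D t
    assume h: "h < min 1 (min e1 e2)" and D: "\<And>t. t \<in> {a..a + h} \<Longrightarrow> \<bar>u1 t - v1 t\<bar> \<le> D"
      and t: "t \<in> {a..a + h}"
    have "0 \<le> D" using D[OF t] by linarith
    have "\<bar>u t - v t\<bar> \<le> D * (t - a)" by (rule abs_diff_le_deriv[OF u v eq(1) D t])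
    also have "\<dots> \<le> D * 1" using t h \<open>0 \<le> D\<close> by (intro mult_left_mono) auto
    finally have "L * \<bar>u t - v t\<bar> \<le> L * D" using dL(2) by simp
    moreover have "\<bar>signed_pow r (u t) - signed_pow r (v t)\<bar> \<le> L * \<bar>u t - v t\<bar>"
      using dL(3)[of "u t" "v t"] e1(2)[of t] e2(2)[of t] t h eq by simp
    ultimately show "\<bar>signed_pow r (u t) - signed_pow r (v t)\<bar> \<le> L * D" by linarith
  qed (use e1 e2 dL in auto)
next
  case True
  with nz have "v1 a \<noteq> 0" by simp
  obtain d L where dL: "0 < d" "0 < L"
    "\<And>x y. \<bar>x - v1 a\<bar> < d \<Longrightarrow> \<bar>y - v1 a\<bar> < d \<Longrightarrow> \<bar>signed_pow r x - signed_pow r y\<bar> \<le> L * \<bar>x - y\<bar>"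
    using signed_pow_locally_Lipschitz[OF \<open>v1 a \<noteq> 0\<close>] by blast
  \<comment> \<open>At a common zero the difference quotients of \<open>u\<close> and
    \<open>v\<close> are close to the nonzero slope, where \<open>signed_pow r\<close> is Lipschitz.
    So the quotients replace the functions themselves.\<close>
  have near: "\<exists>e>0. \<forall>s. s \<noteq> 0 \<and> \<bar>s\<bar> < e \<longrightarrow> \<bar>f (a + s) / s - f1 a\<bar> < d"
    if "\<And>t. (f has_real_derivative f1 t) (at t)" "f a = 0" for f f1
    using that(1)[of a] \<open>0 < d\<close>
    unfolding DERIV_def LIM_def by (simp add: dist_real_def that(2))
  obtain e1 where e1: "0 < e1" "\<And>s. s \<noteq> 0 \<Longrightarrow> \<bar>s\<bar> < e1 \<Longrightarrow> \<bar>u (a + s) / s - u1 a\<bar> < d"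
    using near[OF u] eq True by auto
  obtain e2 where e2: "0 < e2" "\<And>s. s \<noteq> 0 \<Longrightarrow> \<bar>s\<bar> < e2 \<Longrightarrow> \<bar>v (a + s) / s - v1 a\<bar> < d"
    using near[OF v] True by auto
  show ?thesis
  proof (rule that[of "min 1 (min e1 e2)" L])
    fix h D t
    assume h: "h < min 1 (min e1 e2)" and D: "\<And>t. t \<in> {a..a + h} \<Longrightarrow> \<bar>u1 t - v1 t\<bar> \<le> D"
      and t: "t \<in> {a..a + h}"
    have "0 \<le> D" using D[OF t] by linarith
    show "\<bar>signed_pow r (u t) - signed_pow r (v t)\<bar> \<le> L * D"
    proof (cases "t = a")
      case False
      define s where "s = t - a"
      have s: "0 < s" "s < 1" "s < e1" "s < e2" "t = a + s" using False t h by (auto simp: s_def)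
      have "\<bar>signed_pow r (u t / s) - signed_pow r (v t / s)\<bar> \<le> L * \<bar>u t / s - v t / s\<bar>"
        using e1(2)[of s] e2(2)[of s] s eq by (intro dL(3)) auto
      also have "\<bar>u t / s - v t / s\<bar> = \<bar>u t - v t\<bar> / s"
        using s by (simp add: diff_divide_distrib[symmetric])
      also have "\<bar>u t - v t\<bar> \<le> D * s"
        using abs_diff_le_deriv[OF u v eq(1) D t] by (simp add: s_def)
      then have "L * (\<bar>u t - v t\<bar> / s) \<le> L * D" using s dL(2) by (simp add: divide_le_eq)
      finally have *: "\<bar>signed_pow r (u t / s) - signed_pow r (v t / s)\<bar> \<le> L * D" .
      \<comment> \<open>Homogeneity undoes the division by \<open>s\<close>; the factor is at most 1
        because \<open>s < 1\<close> and \<open>r > 1\<close>.\<close>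
      have sc: "signed_pow r x = s powr (r - 1) * signed_pow r (x / s)" for x
        using signed_pow_scale[of s r "x / s"] s by simp
      have "\<bar>signed_pow r (u t) - signed_pow r (v t)\<bar> =
          s powr (r - 1) * \<bar>signed_pow r (u t / s) - signed_pow r (v t / s)\<bar>"
        by (simp add: sc[of "u t"] sc[of "v t"] right_diff_distrib[symmetric] abs_mult)
      also have "\<dots> \<le> 1 * (L * D)"
        using * s r by (intro mult_mono) (auto intro!: powr_le1)
      finally show ?thesis by simp
    qed (use eq \<open>0 \<le> D\<close> dL in simp)
  qed (use e1 e2 dL in auto)
qed

text \<open>A contraction argument on a short interval: the maximum \<open>D\<close> of the
  difference of \<open>U1\<close> and \<open>V1\<close> bounds that of \<open>W1\<close> and
  \<open>Z1\<close> by a multiple of \<open>D * h\<close>, and this in turn bounds \<open>D\<close>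
  by less than itself unless it is 0.\<close>

lemma periodic_solution_local_unique:
  assumes U: "periodic_solution p q l T U U1 W W1" and V: "periodic_solution p q l S V V1 Z Z1"
    and pos: "0 < l" "1 < p" "1 < q"
    and eq: "U a = V a" "U1 a = V1 a" "W a = Z a" "W1 a = Z1 a"
    and nz: "V a \<noteq> 0 \<or> V1 a \<noteq> 0" "Z a \<noteq> 0 \<or> Z1 a \<noteq> 0"
  obtains h where "0 < h"
    "\<And>t. t \<in> {a..a + h} \<Longrightarrow> U t = V t \<and> U1 t = V1 t \<and> W t = Z t \<and> W1 t = Z1 t"
proof -
  have p: "1 < p / (p - 1)" using conjugate_exponent \<open>1 < p\<close> by blast
  have dU: "\<And>t. (U has_real_derivative U1 t) (at t)"
    "\<And>t. (U1 has_real_derivative signed_pow (p / (p - 1)) (W t)) (at t)"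
    "\<And>t. (W has_real_derivative W1 t) (at t)"
    "\<And>t. (W1 has_real_derivative l * signed_pow q (U t)) (at t)"
    using U by (auto simp: periodic_solution_def)
  have dV: "\<And>t. (V has_real_derivative V1 t) (at t)"
    "\<And>t. (V1 has_real_derivative signed_pow (p / (p - 1)) (Z t)) (at t)"
    "\<And>t. (Z has_real_derivative Z1 t) (at t)"
    "\<And>t. (Z1 has_real_derivative l * signed_pow q (V t)) (at t)"
    using V by (auto simp: periodic_solution_def)
  obtain d K where K: "0 < d" "0 < K"
    "\<And>h D t. h < d \<Longrightarrow> (\<And>t. t \<in> {a..a + h} \<Longrightarrow> \<bar>U1 t - V1 t\<bar> \<le> D) \<Longrightarrow> t \<in> {a..a + h} \<Longrightarrow>
      \<bar>signed_pow q (U t) - signed_pow q (V t)\<bar> \<le> K * D"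
    using signed_pow_diff_bound[OF dU(1) dV(1) eq(1,2) nz(1) \<open>1 < q\<close>] by blast
  obtain c M where M: "0 < c" "0 < M"
    "\<And>h D t. h < c \<Longrightarrow> (\<And>t. t \<in> {a..a + h} \<Longrightarrow> \<bar>W1 t - Z1 t\<bar> \<le> D) \<Longrightarrow> t \<in> {a..a + h} \<Longrightarrow>
      \<bar>signed_pow (p / (p - 1)) (W t) - signed_pow (p / (p - 1)) (Z t)\<bar> \<le> M * D"
    using signed_pow_diff_bound[OF dU(3) dV(3) eq(3,4) nz(2) p] by blast
  \<comment> \<open>The last bound makes the contraction factor \<open>l * K * M * h\<close> less
    than 1, and \<open>h < 1\<close> absorbs a second factor of length \<open>h\<close>. Halving
    turns the weak bounds on \<open>m\<close> into strict ones on \<open>h\<close>.\<close>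
  define m where "m = min (min d c) (min 1 (1 / (l * K * M)))"
  define h where "h = m / 2"
  have m: "0 < m" "m \<le> d" "m \<le> c" "m \<le> 1" "m \<le> 1 / (l * K * M)"
    unfolding m_def using K(1,2) M(1,2) \<open>0 < l\<close> by simp_all
  have h: "0 < h" "h < d" "h < c" "h < 1" "h < 1 / (l * K * M)"
    unfolding h_def using m by linarith+
  have "l * K * M * h < 1" using h(5) K(2) M(2) \<open>0 < l\<close> by (simp add: field_simps)
  have "continuous_on {a..a + h} (\<lambda>t. \<bar>U1 t - V1 t\<bar>)"
    using periodic_solution_continuous[OF U] periodic_solution_continuous[OF V]
    by (intro continuous_intros)
  then obtain t0 where t0: "t0 \<in> {a..a + h}" "\<And>t. t \<in> {a..a + h} \<Longrightarrow> \<bar>U1 t - V1 t\<bar> \<le> \<bar>U1 t0 - V1 t0\<bar>"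
    using continuous_attains_sup[of "{a..a+h}" "\<lambda>t. \<bar>U1 t - V1 t\<bar>"] h by auto
  define D where "D = \<bar>U1 t0 - V1 t0\<bar>"
  have D: "0 \<le> D" "\<And>t. t \<in> {a..a + h} \<Longrightarrow> \<bar>U1 t - V1 t\<bar> \<le> D" using t0 by (auto simp: D_def)
  have W1: "\<bar>W1 t - Z1 t\<bar> \<le> l * K * D * h" if t: "t \<in> {a..a + h}" for t
  proof -
    have "\<bar>l * signed_pow q (U t) - l * signed_pow q (V t)\<bar> \<le> l * K * D" if "t \<in> {a..a + h}" for t
      using K(3)[OF h(2) D(2) that] \<open>0 < l\<close> by (simp add: right_diff_distrib[symmetric] abs_mult)
    from abs_diff_le_deriv[OF dU(4) dV(4) eq(4) this t]
    have "\<bar>W1 t - Z1 t\<bar> \<le> l * K * D * (t - a)" .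
    also have "\<dots> \<le> l * K * D * h" using t D K \<open>0 < l\<close> by (intro mult_left_mono) auto
    finally show ?thesis .
  qed
  have "\<bar>U1 t0 - V1 t0\<bar> \<le> M * (l * K * D * h) * (t0 - a)"
    using abs_diff_le_deriv[OF dU(2) dV(2) eq(2) M(3)[OF h(3) W1] t0(1)] .
  also have "\<dots> \<le> M * (l * K * D * h) * 1" using t0(1) D K M h \<open>0 < l\<close> by (intro mult_left_mono) auto
  finally have "D * (1 - l * K * M * h) \<le> 0" by (simp add: D_def algebra_simps)
  with D(1) \<open>l * K * M * h < 1\<close> have "D = 0" by (simp add: mult_le_0_iff)
  have "U t = V t \<and> U1 t = V1 t \<and> W t = Z t \<and> W1 t = Z1 t" if t: "t \<in> {a..a + h}" for t
    using D(2)[OF t] W1[OF t] abs_diff_le_deriv[OF dU(1) dV(1) eq(1) D(2) t]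
      abs_diff_le_deriv[OF dU(3) dV(3) eq(3) W1 t] by (simp add: \<open>D = 0\<close>)
  with h(1) that show ?thesis by blast
qed

text \<open>Equality of \<open>U1 0\<close> and \<open>V1 0\<close> already gives all four initial
  values. The set of agreement is closed, and local uniqueness pushes it beyond the infimum of the
  complement. Only the second solution has to have simple zeros.\<close>

lemma periodic_solution_unique:
  assumes U: "periodic_solution p q l T U U1 W W1" and V: "periodic_solution p q l S V V1 Z Z1"
    and pos: "0 < T" "0 < S" "0 < l" "1 < p" "1 < q"
    and eq: "U1 0 = V1 0"
    and nz: "\<And>t. V t \<noteq> 0 \<or> V1 t \<noteq> 0" "\<And>t. Z t \<noteq> 0 \<or> Z1 t \<noteq> 0"
    and "0 \<le> t"
  shows "U t = V t \<and> W t = Z t"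
proof -
  define E where "E = {t. U t = V t \<and> U1 t = V1 t \<and> W t = Z t \<and> W1 t = Z1 t}"
  have "closed E"
    unfolding E_def using periodic_solution_continuous[OF U] periodic_solution_continuous[OF V]
    by (intro closed_Collect_conj closed_Collect_eq)
  have "0 \<in> E"
    using periodic_solution_at_0[OF U] periodic_solution_at_0[OF V] eq
      periodic_solution_slope_unique[OF U V pos eq] by (simp add: E_def)
  have "t \<in> E" if "0 \<le> t" for t
  proof (rule ccontr)
    assume "t \<notin> E"
    define A where "A = {t. 0 \<le> t \<and> t \<notin> E}"
    have A: "A \<noteq> {}" "bdd_below A" using \<open>t \<notin> E\<close> that by (auto simp: A_def)
    define s where "s = Inf A"
    have "0 \<le> s" unfolding s_def using A by (intro cInf_greatest) (auto simp: A_def)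
    have below: "x \<in> E" if "0 \<le> x" "x < s" for x
      using cInf_lower[OF _ A(2), of x] that by (auto simp: A_def s_def)
    have "s \<in> E"
    proof (cases "s = 0")
      case False
      with \<open>0 \<le> s\<close> have "0 < s" by simp
      have "s \<in> closure {0..<s}" using \<open>0 < s\<close> by simp
      also have "closure {0..<s} \<subseteq> E"
        using below \<open>closed E\<close> by (intro closure_minimal) auto
      finally show ?thesis .
    qed (use \<open>0 \<in> E\<close> in simp)
    then have "U s = V s" "U1 s = V1 s" "W s = Z s" "W1 s = Z1 s" by (auto simp: E_def)
    from periodic_solution_local_unique[OF U V pos(3-5) this nz(1)[of s] nz(2)[of s]]
    obtain h where "0 < h"
      "\<And>t. t \<in> {s..s + h} \<Longrightarrow> U t = V t \<and> U1 t = V1 t \<and> W t = Z t \<and> W1 t = Z1 t" by metis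
    then have h: "0 < h" "{s..s + h} \<subseteq> E" by (auto simp: E_def)
    have "s + h \<le> Inf A"
    proof (intro cInf_greatest A(1))
      fix x assume "x \<in> A"
      then have "0 \<le> x" "x \<notin> E" by (auto simp: A_def)
      with below[of x] have "s \<le> x" by force
      with \<open>x \<notin> E\<close> h(2) show "s + h \<le> x" by force
    qed
    with h(1) show False by (simp add: s_def)
  qed
  with \<open>0 \<le> t\<close> show ?thesis by (simp add: E_def)
qed

subsection \<open>Green's operator on the unit interval\<close>

text \<open>The solution operator of \<open>- u'' = f\<close> with zero boundary values, whose
  kernel is \<open>min x y * (1 - max x y)\<close>. In this form \<open>x\<close> occurs only as a
  factor and as an upper limit, which makes differentiation immediate; \<open>green_split\<close>
  shows the nonnegative kernel.\<close>

definition green :: "(real \<Rightarrow> real) \<Rightarrow> real \<Rightarrow> real" where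
  "green f x = x * integral {0..1} (\<lambda>y. (1 - y) * f y) - x * integral {0..x} f
     + integral {0..x} (\<lambda>y. y * f y)"

definition green_deriv :: "(real \<Rightarrow> real) \<Rightarrow> real \<Rightarrow> real" where
  "green_deriv f x = integral {0..1} (\<lambda>y. (1 - y) * f y) - integral {0..x} f"

context
  fixes f :: "real \<Rightarrow> real"
  assumes f: "continuous_on {0..1} f"
begin

lemma green_has_derivative:
  assumes "x \<in> {0..1}"
  shows "(green f has_real_derivative green_deriv f x) (at x within {0..1})"
    and "(green_deriv f has_real_derivative - f x) (at x within {0..1})"
proof -
  have 1: "((\<lambda>x. integral {0..x} f) has_real_derivative f x) (at x within {0..1})"
    by (rule integral_has_real_derivative[OF f assms])
  have "continuous_on {0..1} (\<lambda>y. y * f y)" using f by (intro continuous_intros)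
  from integral_has_real_derivative[OF this assms]
  have 2: "((\<lambda>x. integral {0..x} (\<lambda>y. y * f y)) has_real_derivative x * f x) (at x within {0..1})" .
  show "(green f has_real_derivative green_deriv f x) (at x within {0..1})"
    unfolding green_def by (auto intro!: derivative_eq_intros 1 2 simp: green_deriv_def)
  show "(green_deriv f has_real_derivative - f x) (at x within {0..1})"
    unfolding green_deriv_def by (auto intro!: derivative_eq_intros 1)
qed

lemma continuous_on_green: "continuous_on {0..1} (green f)" "continuous_on {0..1} (green_deriv f)"
  by (rule DERIV_continuous_on, erule green_has_derivative)+

lemma green_split:
  assumes "x \<in> {0..1}"
  shows "green f x = (1 - x) * integral {0..x} (\<lambda>y. y * f y) + x * integral {x..1} (\<lambda>y. (1 - y) * f y)"
proof -
  have int: "(\<lambda>y. (1 - y) * f y) integrable_on {0..1}"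
    by (intro integrable_continuous_real continuous_intros f)
  have int': "f integrable_on {0..x}" "(\<lambda>y. y * f y) integrable_on {0..x}"
    using assms by (auto intro!: integrable_continuous_real continuous_intros continuous_on_subset[OF f])
  have "integral {0..1} (\<lambda>y. (1 - y) * f y) = integral {0..x} (\<lambda>y. (1 - y) * f y)
      + integral {x..1} (\<lambda>y. (1 - y) * f y)"
    using Henstock_Kurzweil_Integration.integral_combine[OF _ _ int, of x] assms by simp
  also have "integral {0..x} (\<lambda>y. (1 - y) * f y) = integral {0..x} f - integral {0..x} (\<lambda>y. y * f y)"
    using Henstock_Kurzweil_Integration.integral_diff[OF int'] by (simp add: left_diff_distrib)
  finally have eq: "integral {0..1} (\<lambda>y. (1 - y) * f y) = integral {0..x} f
      - integral {0..x} (\<lambda>y. y * f y) + integral {x..1} (\<lambda>y. (1 - y) * f y)" .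
  show ?thesis unfolding green_def eq by (simp add: ring_distribs)
qed

lemma green_0 [simp]: "green f 0 = 0" and green_1 [simp]: "green f 1 = 0"
  using green_split[of 0] green_split[of 1] by simp_all

lemma green_nonneg:
  assumes "\<And>y. y \<in> {0..1} \<Longrightarrow> 0 \<le> f y" "x \<in> {0..1}"
  shows "0 \<le> green f x"
  unfolding green_split[OF assms(2)] using assms
  by (intro add_nonneg_nonneg mult_nonneg_nonneg Henstock_Kurzweil_Integration.integral_nonneg
      integrable_continuous_real continuous_intros continuous_on_subset[OF f]) auto

lemma green_pos:
  assumes nn: "\<And>y. y \<in> {0..1} \<Longrightarrow> 0 \<le> f y" and x: "x \<in> {0<..<1}" and nz: "\<exists>y\<in>{0..1}. f y \<noteq> 0"
  shows "0 < green f x"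
proof (rule ccontr)
  assume "\<not> 0 < green f x"
  with green_nonneg[OF nn, of x] x have "green f x = 0" by auto
  let ?A = "integral {0..x} (\<lambda>y. y * f y)" and ?B = "integral {x..1} (\<lambda>y. (1 - y) * f y)"
  have cA: "continuous_on {0..x} (\<lambda>y. y * f y)" and cB: "continuous_on {x..1} (\<lambda>y. (1 - y) * f y)"
    using x by (auto intro!: continuous_intros continuous_on_subset[OF f])
  have "0 \<le> ?A" "0 \<le> ?B"
    using x nn by (auto intro!: Henstock_Kurzweil_Integration.integral_nonneg
        integrable_continuous_real cA cB)
  moreover have "(1 - x) * ?A + x * ?B = 0" using \<open>green f x = 0\<close> green_split[of x] x by auto
  ultimately have "(1 - x) * ?A = 0 \<and> x * ?B = 0" using x by (intro add_nonneg_eq_0_iff[THEN iffD1]) auto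
  then have "?A = 0" "?B = 0" using x by auto
  then have A: "\<forall>y\<in>{0..x}. y * f y = 0" and B: "\<forall>y\<in>{x..1}. (1 - y) * f y = 0"
    using integral_eq_0_iff[OF cA] integral_eq_0_iff[OF cB] x nn by auto
  have zero: "f y = 0" if "y \<in> {0<..<1}" for y
    using A[rule_format, of y] B[rule_format, of y] that by (cases "y \<le> x") auto
  \<comment> \<open>The weights \<open>y\<close> and \<open>1 - y\<close> vanish at the endpoints,
    so there the value comes from continuity.\<close>
  have "f y = 0" if "y \<in> {0..1}" for y
    using continuous_constant_on_closure[of "{0<..<1}" f 0 y] f zero that by simp
  with nz show False by blast
qed

text \<open>The derivative is a difference of two numbers between 0 and the integral of
  \<open>f\<close>. The constant depends on \<open>f\<close> only through that integral, which
  supplies equicontinuity for Arzela-Ascoli.\<close>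

lemma green_Lipschitz:
  assumes nn: "\<And>y. y \<in> {0..1} \<Longrightarrow> 0 \<le> f y" and "x \<in> {0..1}" "y \<in> {0..1}"
  shows "\<bar>green f x - green f y\<bar> \<le> integral {0..1} f * \<bar>x - y\<bar>"
proof -
  have int: "f integrable_on {0..1}" "(\<lambda>y. (1 - y) * f y) integrable_on {0..1}"
    by (auto intro!: integrable_continuous_real continuous_intros f)
  have "0 \<le> integral {0..1} (\<lambda>y. (1 - y) * f y)"
    using nn by (intro Henstock_Kurzweil_Integration.integral_nonneg int) auto
  moreover have "integral {0..1} (\<lambda>y. (1 - y) * f y) \<le> integral {0..1} f"
  proof (intro Henstock_Kurzweil_Integration.integral_le int)
    fix y :: real assume "y \<in> {0..1}"
    then show "(1 - y) * f y \<le> f y" using mult_right_mono[of "1 - y" 1 "f y"] nn by simp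
  qed
  ultimately have K: "0 \<le> integral {0..1} (\<lambda>y. (1 - y) * f y)"
    "integral {0..1} (\<lambda>y. (1 - y) * f y) \<le> integral {0..1} f" .
  have "\<bar>green_deriv f z\<bar> \<le> integral {0..1} f" if "z \<in> {0..1}" for z
  proof -
    have "f integrable_on {0..z}" using that by (intro integrable_on_subinterval[OF int(1)]) auto
    moreover from this have "0 \<le> integral {0..z} f"
      using that nn by (intro Henstock_Kurzweil_Integration.integral_nonneg) auto
    moreover have "integral {0..z} f \<le> integral {0..1} f"
      using that nn \<open>f integrable_on {0..z}\<close> by (intro integral_subset_le int) auto
    ultimately show ?thesis using K unfolding green_deriv_def by linarith
  qed
  then show ?thesis
    using field_differentiable_bound[of "{0..1}" "green f" "green_deriv f" "integral {0..1} f" x y]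
      green_has_derivative(1) assms(2,3) by simp
qed

lemma green_le:
  assumes nn: "\<And>y. y \<in> {0..1} \<Longrightarrow> 0 \<le> f y" and "x \<in> {0..1}"
  shows "green f x \<le> integral {0..1} f"
proof -
  have "0 \<le> integral {0..1} f"
    using nn by (auto intro!: Henstock_Kurzweil_Integration.integral_nonneg integrable_continuous_real f)
  then have "integral {0..1} f * \<bar>x - 0\<bar> \<le> integral {0..1} f * 1"
    using assms(2) by (intro mult_left_mono) auto
  with green_Lipschitz[OF nn assms(2), of 0] show ?thesis by simp
qed

end

text \<open>Lagrange's identity: the integrands differ by the derivative of the Wronskian-type
  expression \<open>green_deriv f x * green g x - green f x * green_deriv g x\<close>, which
  vanishes at both ends.\<close>

lemma green_symmetric:
  assumes f: "continuous_on {0..1} f" and g: "continuous_on {0..1} g"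
  shows "integral {0..1} (\<lambda>x. green f x * g x) = integral {0..1} (\<lambda>x. f x * green g x)"
proof -
  note cont = continuous_on_green[OF f] continuous_on_green[OF g]
  have "((\<lambda>x. green f x * g x - f x * green g x) has_integral
      (green_deriv f 1 * green g 1 - green f 1 * green_deriv g 1) -
      (green_deriv f 0 * green g 0 - green f 0 * green_deriv g 0)) {0..1}"
  proof (rule fundamental_theorem_of_calculus)
    fix x :: real assume x: "x \<in> {0..1}"
    note d = green_has_derivative[OF f x] green_has_derivative[OF g x]
    have "((\<lambda>x. green_deriv f x * green g x - green f x * green_deriv g x) has_real_derivative
        green f x * g x - f x * green g x) (at x within {0..1})"
      using DERIV_diff[OF DERIV_mult[OF d(2) d(3)] DERIV_mult[OF d(1) d(4)]]
      by (simp add: algebra_simps)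
    then show "((\<lambda>x. green_deriv f x * green g x - green f x * green_deriv g x) has_vector_derivative
        green f x * g x - f x * green g x) (at x within {0..1})"
      by (simp add: has_real_derivative_iff_has_vector_derivative)
  qed simp
  then have "integral {0..1} (\<lambda>x. green f x * g x - f x * green g x) = 0"
    using green_0[OF f] green_0[OF g] green_1[OF f] green_1[OF g] by (simp add: integral_unique)
  moreover have "(\<lambda>x. green f x * g x) integrable_on {0..1}" "(\<lambda>x. f x * green g x) integrable_on {0..1}"
    by (intro integrable_continuous_real continuous_on_mult cont f g)+
  ultimately show ?thesis
    by (simp add: Henstock_Kurzweil_Integration.integral_diff)
qed

subsection \<open>Existence of a positive solution\<close>

lemma powr_tangent_less:
  fixes x r :: real
  assumes "0 < x" "x \<noteq> 1" "1 < r"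
  shows "x < x powr r / r + (1 - 1 / r)"
proof -
  define g where "g x = x powr r / r - x" for x :: real
  have der: "(g has_real_derivative y powr (r - 1) - 1) (at y)" if "0 < y" for y
    unfolding g_def using that assms by (auto intro!: derivative_eq_intros)
  have cont: "continuous_on {a..b} g" if "0 < a" for a b
    using that by (intro DERIV_continuous_on[where D = "\<lambda>y. y powr (r - 1) - 1"])
      (auto intro!: DERIV_subset[OF der])
  have "g 1 < g x"
  proof (cases "1 < x")
    case True
    then show ?thesis
    proof (rule DERIV_pos_imp_increasing_open[where f = g])
      show "\<exists>z. (g has_real_derivative z) (at y) \<and> 0 < z" if "1 < y" "y < x" for y
        using der[of y] that assms gr_one_powr[of y "r - 1"] by (intro exI[of _ "y powr (r - 1) - 1"]) auto
    qed (use cont in auto)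
  next
    case False
    then have "x < 1" using assms by simp
    then show ?thesis
    proof (rule DERIV_neg_imp_decreasing_open[where f = g])
      show "\<exists>z. (g has_real_derivative z) (at y) \<and> z < 0" if "x < y" "y < 1" for y
        using der[of y] that assms powr_less_mono2[of "r - 1" y 1]
        by (intro exI[of _ "y powr (r - 1) - 1"]) auto
    qed (use cont assms in auto)
  qed
  then show ?thesis by (simp add: g_def)
qed

text \<open>By homogeneity this reduces to the tangent inequality at \<open>a / b\<close>. The
  second factor is written as \<open>b powr (r - 1)\<close> so that equality means
  \<open>a = b\<close>.\<close>

lemma Young_powr:
  fixes a b r :: real
  assumes "0 \<le> a" "0 \<le> b" "1 < r"
  shows "a * b powr (r - 1) \<le> a powr r / r + (1 - 1 / r) * b powr r"
    and "a \<noteq> b \<Longrightarrow> a * b powr (r - 1) < a powr r / r + (1 - 1 / r) * b powr r"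
proof -
  show less: "a * b powr (r - 1) < a powr r / r + (1 - 1 / r) * b powr r" if "a \<noteq> b"
  proof (cases "a = 0 \<or> b = 0")
    case True
    then show ?thesis using that assms by auto
  next
    case False
    then have pos: "0 < a" "0 < b" using assms by auto
    then have "a / b < (a / b) powr r / r + (1 - 1 / r)"
      using that assms by (intro powr_tangent_less) auto
    then have "b powr r * (a / b) < b powr r * ((a / b) powr r / r + (1 - 1 / r))"
      using pos by (intro mult_strict_left_mono) auto
    also have "\<dots> = a powr r / r + (1 - 1 / r) * b powr r"
      using pos by (simp add: powr_divide algebra_simps)
    also have "b powr r * (a / b) = a * b powr (r - 1)"
      using pos by (simp add: powr_diff)
    finally show ?thesis .
  qed
  have "a * a powr (r - 1) = a powr r" using assms by (cases "a = 0") (auto simp: powr_diff)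
  then have "a * b powr (r - 1) = a powr r / r + (1 - 1 / r) * b powr r" if "a = b"
    using that by (simp add: left_diff_distrib)
  with less show "a * b powr (r - 1) \<le> a powr r / r + (1 - 1 / r) * b powr r"
    by (cases "a = b") (simp_all add: less_imp_le)
qed

lemma continuous_on_powr_pos:
  fixes f :: "real \<Rightarrow> real"
  assumes "continuous_on S f" "\<And>x. x \<in> S \<Longrightarrow> 0 \<le> f x" "0 < r"
  shows "continuous_on S (\<lambda>x. f x powr r)"
  using assms by (intro continuous_on_powr' continuous_intros) auto

lemma green_cong:
  assumes "\<And>x. x \<in> {0..1} \<Longrightarrow> f x = g x" "x \<in> {0..1}"
  shows "green f x = green g x"
proof -
  have "integral {0..x} f = integral {0..x} g" "integral {0..x} (\<lambda>y. y * f y) = integral {0..x} (\<lambda>y. y * g y)"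
    "integral {0..1} (\<lambda>y. (1 - y) * f y) = integral {0..1} (\<lambda>y. (1 - y) * g y)"
    using assms by (auto intro!: Henstock_Kurzweil_Integration.integral_cong)
  then show ?thesis by (simp add: green_def)
qed

text \<open>The identity for \<open>h\<close> is the Euler-Lagrange equation of the constrained
  problem. It will provide \<open>w = - (h powr (p - 1))\<close> with two derivatives, and
  \<open>1 / M\<close> as the eigenvalue.\<close>

lemma green_maximizer:
  fixes p q :: real
  assumes p: "1 < p" and q: "1 < q"
  obtains h M where "continuous_on {0..1} h" "\<And>x. x \<in> {0..1} \<Longrightarrow> 0 \<le> h x"
    "integral {0..1} (\<lambda>x. h x powr p) = 1" "0 < M"
    "\<And>x. x \<in> {0..1} \<Longrightarrow> green (\<lambda>y. green h y powr (q - 1)) x = M * h x powr (p - 1)"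
proof -
  define A where "A = {h :: real \<Rightarrow> real. continuous_on {0..1} h \<and> (\<forall>x\<in>{0..1}. 0 \<le> h x) \<and>
    integral {0..1} (\<lambda>x. h x powr p) = 1}"
  define J where "J h = integral {0..1} (\<lambda>x. green h x powr q)" for h
  have A_D: "continuous_on {0..1} h" "\<And>x. x \<in> {0..1} \<Longrightarrow> 0 \<le> h x"
    "integral {0..1} (\<lambda>x. h x powr p) = 1" if "h \<in> A" for h
    using that by (auto simp: A_def)
  have int_powr: "(\<lambda>x. h x powr r) integrable_on {0..1}"
    if "continuous_on {0..1} h" "\<And>x. x \<in> {0..1} \<Longrightarrow> 0 \<le> h x" "0 < r" for h :: "real \<Rightarrow> real" and r
    using that by (auto intro!: integrable_continuous_real continuous_on_powr_pos)
  \<comment> \<open>From the pointwise bound \<open>h \<le> 1 + h powr p\<close>; the only uniform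
    bound on the admissible functions that compactness needs.\<close>
  have int_le_2: "integral {0..1} h \<le> 2" if "h \<in> A" for h
  proof -
    have "integral {0..1} h \<le> integral {0..1} (\<lambda>x. 1 + h x powr p)"
    proof (rule Henstock_Kurzweil_Integration.integral_le)
      show "h integrable_on {0..1}" by (intro integrable_continuous_real A_D(1) that)
      show "(\<lambda>x. 1 + h x powr p) integrable_on {0..1}"
        using int_powr[OF A_D(1,2)[OF that]] p by (intro Henstock_Kurzweil_Integration.integrable_add) auto
      fix x :: real assume "x \<in> {0..1}"
      then have "0 \<le> h x" using A_D[OF that] by auto
      then show "h x \<le> 1 + h x powr p"
      proof (cases "1 \<le> h x")
        case False
        then show ?thesis using powr_ge_zero[of "h x" p] by linarith
      qed (use powr_mono[of 1 p "h x"] p in auto)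
    qed
    also have "\<dots> = 2"
      using int_powr[OF A_D(1,2)[OF that], of p] A_D(3)[OF that] p
      by (subst Henstock_Kurzweil_Integration.integral_add) auto
    finally show ?thesis .
  qed
  have gnn: "0 \<le> green h x" and gle: "green h x \<le> 2" if "h \<in> A" "x \<in> {0..1}" for h x
    using green_nonneg[OF A_D(1,2)[OF that(1)] that(2)] green_le[OF A_D(1,2)[OF that(1)] that(2)]
      int_le_2[OF that(1)] by auto
  have int_J: "(\<lambda>x. green h x powr q) integrable_on {0..1}" if "h \<in> A" for h
    using q gnn[OF that] by (intro int_powr continuous_on_green A_D[OF that]) auto
  have J_le: "J h \<le> 2 powr q" if "h \<in> A" for h
  proof -
    have "J h \<le> integral {0..1} (\<lambda>x::real. 2 powr q)"
      unfolding J_def using gnn[OF that] gle[OF that] q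
      by (intro Henstock_Kurzweil_Integration.integral_le int_J that powr_mono2) auto
    then show ?thesis by simp
  qed
  define S where "S = Sup (J ` A)"
  have bdd: "bdd_above (J ` A)" using J_le by (intro bdd_aboveI[of _ "2 powr q"]) auto
  have J_le_S: "J h \<le> S" if "h \<in> A" for h
    unfolding S_def using that bdd by (intro cSup_upper) auto
  have one: "(\<lambda>x. 1) \<in> A" by (simp add: A_def)
  have "0 < J (\<lambda>x. 1)"
  proof -
    have "integral {0..1} (\<lambda>x::real. 0) < J (\<lambda>x. 1)"
      unfolding J_def using q
    proof (intro integral_less_real)
      show "continuous_on {0..1} (\<lambda>x. green (\<lambda>x. 1) x powr q)"
        using q gnn[OF one] by (intro continuous_on_powr_pos continuous_on_green A_D[OF one]) auto
      show "0 < green (\<lambda>x. 1) x powr q" if "x \<in> {0<..<1}" for x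
      proof -
        have "0 < green (\<lambda>x. 1) x" by (rule green_pos[OF A_D(1)[OF one] _ that]) auto
        then show ?thesis by simp
      qed
    qed auto
    then show ?thesis by simp
  qed
  with J_le_S[OF one] have "0 < S" by simp
  have "\<exists>h\<in>A. S - 1 / Suc n < J h" for n
    using less_cSup_iff[of "J ` A" "S - 1 / Suc n"] one bdd by (auto simp: S_def)
  then obtain h where h: "\<And>n. h n \<in> A" "\<And>n. S - 1 / Suc n < J (h n)" by metis
  note hA = A_D[OF h(1)]
  have J_lim: "(\<lambda>n. J (h n)) \<longlonglongrightarrow> S"
  proof (rule tendsto_sandwich)
    show "(\<lambda>n. S - 1 / Suc n) \<longlonglongrightarrow> S"
      using tendsto_diff[OF tendsto_const LIMSEQ_inverse_real_of_nat, of S] by (simp add: inverse_eq_divide)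
    show "\<forall>\<^sub>F n in sequentially. S - 1 / Suc n \<le> J (h n)"
      by (intro always_eventually allI less_imp_le h(2))
    show "\<forall>\<^sub>F n in sequentially. J (h n) \<le> S"
      by (intro always_eventually allI J_le_S h(1))
  qed simp
  obtain u k where u: "continuous_on {0..1} u" "strict_mono (k :: nat \<Rightarrow> nat)"
    "\<And>e. 0 < e \<Longrightarrow> \<exists>N. \<forall>n x. n \<ge> N \<and> x \<in> {0..1} \<longrightarrow> norm (green (h (k n)) x - u x) < e"
  proof (rule Arzela_Ascoli[of "{0..1::real}" "\<lambda>n. green (h n)" 2])
    show "norm (green (h n) x) \<le> 2" if "x \<in> {0..1}" for n x
      using gnn[OF h(1) that] gle[OF h(1) that] by simp
    show "\<exists>d>0. \<forall>n y. y \<in> {0..1} \<and> norm (x - y) < d \<longrightarrow> norm (green (h n) x - green (h n) y) < e"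
      if "x \<in> {0..1}" "0 < e" for x e
    proof (intro exI[of _ "e / 2"] conjI allI impI)
      fix n y assume y: "y \<in> {0..1} \<and> norm (x - y) < e / 2"
      have "\<bar>green (h n) x - green (h n) y\<bar> \<le> integral {0..1} (h n) * \<bar>x - y\<bar>"
        using y that by (intro green_Lipschitz hA) auto
      also have "\<dots> \<le> 2 * \<bar>x - y\<bar>" using int_le_2[OF h(1)] by (intro mult_right_mono) auto
      finally show "norm (green (h n) x - green (h n) y) < e" using y by simp
    qed (use that in simp)
  qed auto
  have u_lim: "(\<lambda>n. green (h (k n)) x) \<longlonglongrightarrow> u x" if "x \<in> {0..1}" for x
    unfolding LIMSEQ_iff using u(3) that by blast
  have u_nn: "0 \<le> u x" if "x \<in> {0..1}" for x
    using LIMSEQ_le_const[OF u_lim[OF that], of 0] gnn[OF h(1) that] by auto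
  have uq: "(\<lambda>x. u x powr r) integrable_on {0..1}" "continuous_on {0..1} (\<lambda>x. u x powr r)" if "0 < r" for r
    using u(1) u_nn that by (auto intro!: int_powr continuous_on_powr_pos)
  have "(\<lambda>n. J (h (k n))) \<longlonglongrightarrow> integral {0..1} (\<lambda>x. u x powr q)"
    unfolding J_def
  proof (rule dominated_convergence(2))
    show "(\<lambda>x. green (h (k n)) x powr q) integrable_on {0..1}" for n by (rule int_J[OF h(1)])
    show "norm (green (h (k n)) x powr q) \<le> 2 powr q" if "x \<in> {0..1}" for n x
      using gnn[OF h(1) that] gle[OF h(1) that] q by (auto intro!: powr_mono2)
    show "(\<lambda>n. green (h (k n)) x powr q) \<longlonglongrightarrow> u x powr q" if "x \<in> {0..1}" for x
      using u_lim[OF that] q gnn[OF h(1) that] by (intro tendsto_powr') auto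
  qed auto
  moreover have "(\<lambda>n. J (h (k n))) \<longlonglongrightarrow> S"
    using LIMSEQ_subseq_LIMSEQ[OF J_lim u(2)] by (simp add: o_def)
  ultimately have S_eq: "integral {0..1} (\<lambda>x. u x powr q) = S" by (rule LIMSEQ_unique)
  have "\<exists>x\<in>{0..1}. u x \<noteq> 0"
  proof (rule ccontr)
    assume "\<not> (\<exists>x\<in>{0..1}. u x \<noteq> 0)"
    then have "integral {0..1} (\<lambda>x. u x powr q) = integral {0..1} (\<lambda>x::real. 0)"
      by (intro Henstock_Kurzweil_Integration.integral_cong) auto
    with S_eq \<open>0 < S\<close> show False by simp
  qed
  \<comment> \<open>Up to a constant, \<open>v\<close> is the gradient of the integral of
    \<open>u powr q\<close>, and \<open>g = green v\<close> is its pullback to the variable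
    \<open>h\<close>.\<close>
  define v where "v = (\<lambda>x. u x powr (q - 1))"
  have v: "continuous_on {0..1} v" "\<And>x. x \<in> {0..1} \<Longrightarrow> 0 \<le> v x" "\<exists>x\<in>{0..1}. v x \<noteq> 0"
    using uq q \<open>\<exists>x\<in>{0..1}. u x \<noteq> 0\<close> by (auto simp: v_def)
  define g where "g = green v"
  have g: "continuous_on {0..1} g" "\<And>x. x \<in> {0..1} \<Longrightarrow> 0 \<le> g x" "\<And>x. x \<in> {0<..<1} \<Longrightarrow> 0 < g x"
    unfolding g_def using v by (auto intro!: continuous_on_green green_nonneg green_pos)
  define N where "N = integral {0..1} (\<lambda>x. g x powr (p / (p - 1)))"
  have p': "0 < p / (p - 1)" "0 < 1 / (p - 1)" using p by simp_all
  have "integral {0..1} (\<lambda>x::real. 0) < N"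
    unfolding N_def
  proof (intro integral_less_real)
    show "continuous_on {0..1} (\<lambda>x. g x powr (p / (p - 1)))"
      by (intro continuous_on_powr_pos g p'(1))
    show "0 < g x powr (p / (p - 1))" if "x \<in> {0<..<1}" for x
      using g(3)[OF that] by simp
  qed auto
  then have "0 < N" by simp
  \<comment> \<open>\<open>M\<close> is the norm of \<open>g\<close> for the exponent conjugate to
    \<open>p\<close>, and \<open>f\<close> below is the normalized function for which Hoelder's
    inequality against \<open>g\<close> is an equality.\<close>
  define M where "M = N powr ((p - 1) / p)"
  have "0 < M" using \<open>0 < N\<close> by (simp add: M_def)
  define f where "f = (\<lambda>x. g x powr (1 / (p - 1)) / N powr (1 / p))"
  have f: "continuous_on {0..1} f" "\<And>x. 0 \<le> f x"
    unfolding f_def using g p' \<open>0 < N\<close> by (auto intro!: continuous_intros continuous_on_powr_pos)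
  have f_p: "f x powr p = g x powr (p / (p - 1)) / N" if "x \<in> {0..1}" for x
    using \<open>0 < N\<close> g(2)[OF that] p by (simp add: f_def powr_divide powr_powr)
  have f_p1: "g x = M * f x powr (p - 1)" if "x \<in> {0..1}" for x
    using \<open>0 < N\<close> g(2)[OF that] p by (simp add: f_def M_def powr_divide powr_powr)
  have "integral {0..1} (\<lambda>x. f x powr p) = integral {0..1} (\<lambda>x. g x powr (p / (p - 1)) / N)"
    by (intro Henstock_Kurzweil_Integration.integral_cong f_p)
  also have "\<dots> = 1" using \<open>0 < N\<close> by (simp add: N_def[symmetric])
  finally have f_norm: "integral {0..1} (\<lambda>x. f x powr p) = 1" .
  have "f \<in> A" using f f_norm by (simp add: A_def)
  have int_mult: "(\<lambda>x. a x * b x) integrable_on {0..1}" if "continuous_on {0..1} a" "continuous_on {0..1} b"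
    for a b :: "real \<Rightarrow> real"
    by (intro integrable_continuous_real continuous_on_mult that)
  text \<open>Young's inequality identifies \<open>f\<close> as the maximizer of the pairing with \<open>g\<close>.\<close>
  have pair: "integral {0..1} (\<lambda>x. a x * g x) \<le> M" if "a \<in> A" for a
  proof -
    note aD = A_D[OF that]
    have ia: "(\<lambda>x. a x powr p / p) integrable_on {0..1}"
      using int_powr[OF aD(1,2), of p] p by (auto intro: integrable_on_divide)
    have ib: "(\<lambda>x. (1 - 1 / p) * f x powr p) integrable_on {0..1}"
      using int_powr[OF f, of p] p by (auto intro: integrable_on_mult_right)
    have "integral {0..1} (\<lambda>x. a x * f x powr (p - 1))
        \<le> integral {0..1} (\<lambda>x. a x powr p / p + (1 - 1 / p) * f x powr p)"
      using p aD f
      by (intro Henstock_Kurzweil_Integration.integral_le int_mult Henstock_Kurzweil_Integration.integrable_add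
          ia ib Young_powr(1) continuous_on_powr_pos) auto
    also have "\<dots> = integral {0..1} (\<lambda>x. a x powr p) / p + (1 - 1 / p) * integral {0..1} (\<lambda>x. f x powr p)"
      by (subst Henstock_Kurzweil_Integration.integral_add[OF ia ib]) simp
    also have "\<dots> = 1" using aD f_norm by simp
    finally have "M * integral {0..1} (\<lambda>x. a x * f x powr (p - 1)) \<le> M" using \<open>0 < M\<close> by simp
    moreover have "integral {0..1} (\<lambda>x. a x * g x) = integral {0..1} (\<lambda>x. M * (a x * f x powr (p - 1)))"
      by (intro Henstock_Kurzweil_Integration.integral_cong) (simp add: f_p1)
    ultimately show ?thesis by simp
  qed
  have "integral {0..1} (\<lambda>x. f x * g x) = integral {0..1} (\<lambda>x. M * f x powr p)"
  proof (intro Henstock_Kurzweil_Integration.integral_cong)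
    fix x :: real assume "x \<in> {0..1}"
    then show "f x * g x = M * f x powr p"
      using f(2)[of x] p by (cases "f x = 0") (auto simp: f_p1 powr_diff)
  qed
  then have fg: "integral {0..1} (\<lambda>x. f x * g x) = M" using f_norm by simp
  \<comment> \<open>By symmetry of \<open>green\<close> the integrals on the left pair
    \<open>h (k n)\<close> with \<open>g\<close>, so they are at most \<open>M\<close>; the limit is
    the integral of \<open>u powr q\<close>, that is \<open>S\<close>. This gives
    \<open>S \<le> M\<close>.\<close>
  have "(\<lambda>n. integral {0..1} (\<lambda>x. green (h (k n)) x * v x)) \<longlonglongrightarrow> integral {0..1} (\<lambda>x. u x * v x)"
  proof (rule dominated_convergence(2))
    show "(\<lambda>x. green (h (k n)) x * v x) integrable_on {0..1}" for n
      by (intro int_mult v continuous_on_green hA)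
    show "(\<lambda>x. 2 * v x) integrable_on {0..1}" using v by (intro int_mult) auto
    show "norm (green (h (k n)) x * v x) \<le> 2 * v x" if "x \<in> {0..1}" for n x
      using gnn[OF h(1) that] gle[OF h(1) that] v(2)[OF that] by (auto simp: abs_mult intro: mult_right_mono)
    show "(\<lambda>n. green (h (k n)) x * v x) \<longlonglongrightarrow> u x * v x" if "x \<in> {0..1}" for x
      using u_lim[OF that] by (intro tendsto_intros)
  qed
  moreover have "integral {0..1} (\<lambda>x. green (h (k n)) x * v x) \<le> M" for n
    using green_symmetric[OF hA(1) v(1), of "k n"] pair[OF h(1), of "k n"] by (simp add: g_def)
  ultimately have "integral {0..1} (\<lambda>x. u x * v x) \<le> M" by (intro LIMSEQ_le_const2) auto
  moreover have "integral {0..1} (\<lambda>x. u x * v x) = S"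
  proof -
    have "u x * v x = u x powr q" if "x \<in> {0..1}" for x
      using u_nn[OF that] q by (cases "u x = 0") (auto simp: v_def powr_diff)
    then show ?thesis unfolding S_eq[symmetric] by (intro Henstock_Kurzweil_Integration.integral_cong)
  qed
  moreover have "M = integral {0..1} (\<lambda>x. green f x * v x)"
    using green_symmetric[OF f(1) v(1)] fg by (simp add: g_def)
  ultimately have S_le: "S \<le> integral {0..1} (\<lambda>x. green f x * v x)" by simp
  \<comment> \<open>The deficit in Young's inequality between \<open>green f\<close> and
    \<open>u\<close>. It is nonnegative, but its integral is at most 0 because
    \<open>J f \<le> S\<close> and the pairing with \<open>v\<close> is at least \<open>S\<close>.
    Hence it vanishes, and the equality case gives \<open>green f = u\<close>.\<close>
  define D where "D = (\<lambda>x. green f x powr q / q + (1 - 1 / q) * u x powr q - green f x * v x)"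
  have D_nn: "0 \<le> D x" if "x \<in> {0..1}" for x
    unfolding D_def v_def using Young_powr(1)[of "green f x" "u x" q] gnn[OF \<open>f \<in> A\<close> that] u_nn[OF that] q
    by simp
  have D_cont: "continuous_on {0..1} D"
  proof -
    have 1: "continuous_on {0..1} (\<lambda>x. green f x powr q)"
      using q gnn[OF \<open>f \<in> A\<close>] by (intro continuous_on_powr_pos continuous_on_green f) auto
    have 2: "continuous_on {0..1} (\<lambda>x. u x powr q)" using uq(2)[of q] q by simp
    have "continuous_on {0..1} (\<lambda>x. 1 / q * green f x powr q + (1 - 1 / q) * u x powr q - green f x * v x)"
      by (intro continuous_on_add continuous_on_diff continuous_on_mult continuous_on_const 1 2 v(1)
          continuous_on_green(1) f(1))
    then show ?thesis by (simp add: D_def)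
  qed
  have i1: "(\<lambda>x. green f x powr q / q) integrable_on {0..1}"
    using int_J[OF \<open>f \<in> A\<close>] by (auto intro: integrable_on_divide)
  have i2: "(\<lambda>x. (1 - 1 / q) * u x powr q) integrable_on {0..1}"
    using uq[of q] q by (auto intro: integrable_on_mult_right)
  have i3: "(\<lambda>x. green f x * v x) integrable_on {0..1}" by (intro int_mult v continuous_on_green f)
  have "integral {0..1} D = J f / q + (1 - 1 / q) * S - integral {0..1} (\<lambda>x. green f x * v x)"
    unfolding D_def
    by (subst Henstock_Kurzweil_Integration.integral_diff[OF Henstock_Kurzweil_Integration.integrable_add[OF i1 i2] i3],
        subst Henstock_Kurzweil_Integration.integral_add[OF i1 i2]) (simp add: J_def S_eq)
  also have "\<dots> \<le> S / q + (1 - 1 / q) * S - S"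
    using S_le J_le_S[OF \<open>f \<in> A\<close>] q by (intro diff_mono add_mono divide_right_mono) auto
  also have "\<dots> = 0" by (simp add: left_diff_distrib)
  finally have "integral {0..1} D = 0"
    using Henstock_Kurzweil_Integration.integral_nonneg[OF integrable_continuous_real[OF D_cont] D_nn] by simp
  then have "D x = 0" if "x \<in> {0..1}" for x
    using integral_eq_0_iff[OF D_cont _ D_nn] that by auto
  then have eq: "green f x = u x" if "x \<in> {0..1}" for x
    using Young_powr(2)[of "green f x" "u x" q] gnn[OF \<open>f \<in> A\<close> that] u_nn[OF that] q that
    unfolding D_def v_def by fastforce
  show ?thesis
  proof (rule that[of f M])
    show "green (\<lambda>y. green f y powr (q - 1)) x = M * f x powr (p - 1)" if "x \<in> {0..1}" for x
      using green_cong[of "\<lambda>y. green f y powr (q - 1)" v x] eq f_p1[OF that] that by (simp add: v_def g_def)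
  qed (use f f_norm \<open>0 < M\<close> in auto)
qed

lemma positive_solution_exists:
  assumes p: "1 < p" and q: "1 < q"
  obtains l U U1 W W1 where "periodic_solution p q l 1 U U1 W W1" "0 < l"
    "\<And>t. t \<in> {0<..<1} \<Longrightarrow> 0 < U t" "\<And>t. t \<in> {0<..<1} \<Longrightarrow> W t < 0"
    "integral {0..1} (\<lambda>t. \<bar>W t\<bar> powr (p / (p - 1))) = 1"
proof -
  obtain h M where h: "continuous_on {0..1} h" "\<And>x. x \<in> {0..1} \<Longrightarrow> 0 \<le> h x"
    "integral {0..1} (\<lambda>x. h x powr p) = 1" "0 < M"
    "\<And>x. x \<in> {0..1} \<Longrightarrow> green (\<lambda>y. green h y powr (q - 1)) x = M * h x powr (p - 1)"
    using green_maximizer[OF p q] by blast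
  define v where "v = (\<lambda>y. green h y powr (q - 1))"
  \<comment> \<open>On the interval this is \<open>- (h powr (p - 1))\<close>, but written through
    \<open>green\<close>, so that its two derivatives are available although \<open>h\<close> is
    only known to be continuous.\<close>
  define w where "w = (\<lambda>x. - (1 / M) * green v x)"
  have hn: "\<exists>x\<in>{0..1}. h x \<noteq> 0"
  proof (rule ccontr)
    assume "\<not> (\<exists>x\<in>{0..1}. h x \<noteq> 0)"
    then have "integral {0..1} (\<lambda>x. h x powr p) = integral {0..1} (\<lambda>x::real. 0)"
      by (intro Henstock_Kurzweil_Integration.integral_cong) auto
    with h(3) show False by simp
  qed
  have u: "0 \<le> green h x" if "x \<in> {0..1}" for x by (rule green_nonneg[OF h(1,2) that])
  have upos: "0 < green h x" if "x \<in> {0<..<1}" for x by (rule green_pos[OF h(1,2) that hn])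
  have v: "continuous_on {0..1} v" "\<And>x. x \<in> {0..1} \<Longrightarrow> 0 \<le> v x"
    unfolding v_def using q u by (auto intro!: continuous_on_powr_pos continuous_on_green h(1))
  have vn: "\<exists>x\<in>{0..1}. v x \<noteq> 0"
    using upos[of "1/2"] by (intro bexI[of _ "1/2"]) (auto simp: v_def)
  have w: "w x = - (h x powr (p - 1))" if "x \<in> {0..1}" for x
    using h(4) h(5)[OF that] by (simp add: w_def v_def)
  have sw: "signed_pow (p / (p - 1)) (w x) = - h x" if "x \<in> {0..1}" for x
  proof -
    have "signed_pow (p / (p - 1)) (w x) = - signed_pow (p / (p - 1)) (signed_pow p (h x))"
      by (simp only: w[OF that] signed_pow_minus signed_pow_nonneg[OF h(2)[OF that]])
    then show ?thesis using signed_pow_signed_pow conjugate_exponent(3)[OF p] by simp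
  qed
  have d: "(green h has_real_derivative green_deriv h x) (at x within {0..1})"
    "(green_deriv h has_real_derivative signed_pow (p / (p - 1)) (w x)) (at x within {0..1})"
    "(w has_real_derivative - (1 / M) * green_deriv v x) (at x within {0..1})"
    "((\<lambda>x. - (1 / M) * green_deriv v x) has_real_derivative 1 / M * signed_pow q (green h x))
       (at x within {0..1})" if x: "x \<in> {0..1}" for x
  proof -
    show "(green h has_real_derivative green_deriv h x) (at x within {0..1})"
      by (rule green_has_derivative(1)[OF h(1) x])
    show "(green_deriv h has_real_derivative signed_pow (p / (p - 1)) (w x)) (at x within {0..1})"
      unfolding sw[OF x] by (rule green_has_derivative(2)[OF h(1) x])
    show "(w has_real_derivative - (1 / M) * green_deriv v x) (at x within {0..1})"
      unfolding w_def by (rule DERIV_cmult[OF green_has_derivative(1)[OF v(1) x]])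
    have "- (1 / M) * - v x = 1 / M * signed_pow q (green h x)"
      using u[OF x] by (simp add: signed_pow_nonneg v_def)
    then show "((\<lambda>x. - (1 / M) * green_deriv v x) has_real_derivative 1 / M * signed_pow q (green h x))
       (at x within {0..1})"
      using DERIV_cmult[OF green_has_derivative(2)[OF v(1) x], of "- (1 / M)"] by (simp only:)
  qed
  have zero: "green h 0 = 0" "green h 1 = 0" "w 0 = 0" "w 1 = 0"
    by (simp_all add: w_def green_0 green_1 h(1) v(1))
  obtain U U1 W W1 where sol: "periodic_solution p q (1 / M) 1 U U1 W W1"
    "\<And>t. t \<in> {0..1} \<Longrightarrow> U t = green h t" "\<And>t. t \<in> {0..1} \<Longrightarrow> W t = w t"
    using periodic_solution_extend[OF zero_less_one d zero] by metis
  show ?thesis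
  proof (rule that[OF sol(1)])
    show "0 < U t" "W t < 0" if "t \<in> {0<..<1}" for t
      using sol(2,3)[of t] that upos[OF that] green_pos[OF v that vn] h(4) by (auto simp: w_def)
    have "integral {0..1} (\<lambda>t. \<bar>W t\<bar> powr (p / (p - 1))) = integral {0..1} (\<lambda>x. h x powr p)"
      using sol(3) w p h(2)
      by (intro Henstock_Kurzweil_Integration.integral_cong) (simp add: powr_powr)
    then show "integral {0..1} (\<lambda>t. \<bar>W t\<bar> powr (p / (p - 1))) = 1" using h(3) by simp
  qed (use h(4) in simp)
qed

subsection \<open>Classification of the spectral couples\<close>

text \<open>Strict concavity makes the slope strictly decreasing, and it vanishes somewhere inside
  by Rolle, so it is positive at 0 and negative at 1. The lemma serves both for \<open>U\<close> and
  for \<open>- W\<close>.\<close>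

lemma concave_arch_simple_zeros:
  fixes F F1 F2 :: "real \<Rightarrow> real"
  assumes F: "sym_periodic (- 1) 1 F" and F1: "sym_periodic 1 1 F1"
    and der: "\<And>t. (F has_real_derivative F1 t) (at t)" "\<And>t. (F1 has_real_derivative F2 t) (at t)"
    and pos: "\<And>t. t \<in> {0<..<1} \<Longrightarrow> 0 < F t" and neg: "\<And>t. t \<in> {0<..<1} \<Longrightarrow> F2 t < 0"
  shows "0 < F1 0" "F t = 0 \<Longrightarrow> t \<in> \<int>" "F t \<noteq> 0 \<or> F1 t \<noteq> 0"
proof -
  have dec: "F1 b < F1 a" if "0 \<le> a" "a < b" "b \<le> 1" for a b
  proof (rule DERIV_neg_imp_decreasing_open[where f = F1, OF that(2)])
    show "\<exists>y. (F1 has_real_derivative y) (at x) \<and> y < 0" if "a < x" "x < b" for x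
      using der(2)[of x] neg[of x] that \<open>0 \<le> a\<close> \<open>b \<le> 1\<close> by (intro exI[of _ "F2 x"]) auto
    show "continuous_on {a..b} F1"
      by (rule DERIV_continuous_on, rule DERIV_subset[OF der(2)]) simp
  qed
  have "F 0 = 0" "F 1 = 0" using sym_periodic_odd_zero[OF F, of 0] sym_periodic_odd_zero[OF F, of 1] by auto
  then obtain z where z: "0 < z" "z < 1" "F1 z = 0"
    using MVT2[of 0 1 F F1] der(1) by auto
  have ends: "0 < F1 0" "F1 1 < 0" using dec[of 0 z] dec[of z 1] z by auto
  then show "0 < F1 0" by simp
  obtain k r where r: "t = r + of_int k * (2 * 1)" "- 1 \<le> r" "r < 1"
    by (rule periodic_reduce[OF zero_less_one, of t])
  have t: "F t = F r" "F1 t = F1 r"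
    unfolding r(1) by (rule sym_periodic_add_int[OF F] sym_periodic_add_int[OF F1])+
  consider "r = 0" | "r = - 1" | "0 < r" | "r < 0" "- 1 < r" using r by linarith
  then have "F r \<noteq> 0 \<or> r \<in> \<int> \<and> F1 r \<noteq> 0"
  proof cases
    case 2
    then show ?thesis using ends sym_periodic_minus[OF F1, of 1] by simp
  next
    case 3
    then show ?thesis using pos[of r] r by auto
  next
    case 4
    then show ?thesis using pos[of "- r"] sym_periodic_minus[OF F, of r] by auto
  qed (use ends in simp)
  moreover have "t \<in> \<int>" if "r \<in> \<int>" using that by (simp add: r(1))
  ultimately show "F t = 0 \<Longrightarrow> t \<in> \<int>" "F t \<noteq> 0 \<or> F1 t \<noteq> 0" using t by auto
qed

text \<open>One arch is fixed as reference. That it is the only one with these properties is not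
  assumed; it comes out of the classification for \<open>T = 1\<close>.\<close>

locale positive_solution =
  fixes p q l :: real and U U1 W W1 :: "real \<Rightarrow> real"
  assumes p: "1 < p" and q: "1 < q" and l: "0 < l"
    and sol: "periodic_solution p q l 1 U U1 W W1"
    and U_pos: "\<And>t. t \<in> {0<..<1} \<Longrightarrow> 0 < U t" and W_neg: "\<And>t. t \<in> {0<..<1} \<Longrightarrow> W t < 0"
    and W_norm: "integral {0..1} (\<lambda>t. \<bar>W t\<bar> powr (p / (p - 1))) = 1"
begin

lemma U_simple: "0 < U1 0" "U t = 0 \<Longrightarrow> t \<in> \<int>" "U t \<noteq> 0 \<or> U1 t \<noteq> 0"
proof -
  have neg: "signed_pow (p / (p - 1)) (W t) < 0" if "t \<in> {0<..<1}" for t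
    using W_neg[OF that] by (metis sgn_less sgn_signed_pow)
  have "sym_periodic (- 1) 1 U" "sym_periodic 1 1 U1" "\<And>t. (U has_real_derivative U1 t) (at t)"
    "\<And>t. (U1 has_real_derivative signed_pow (p / (p - 1)) (W t)) (at t)"
    using sol by (auto simp: periodic_solution_def)
  note * = concave_arch_simple_zeros[OF this U_pos neg]
  show "0 < U1 0" by (rule *(1))
  show "U t = 0 \<Longrightarrow> t \<in> \<int>" by (rule *(2))
  show "U t \<noteq> 0 \<or> U1 t \<noteq> 0" by (rule *(3))
qed

lemma W_simple: "W t \<noteq> 0 \<or> W1 t \<noteq> 0"
proof -
  have neg: "- (l * signed_pow q (U t)) < 0" if "t \<in> {0<..<1}" for t
  proof -
    have "0 < signed_pow q (U t)" using U_pos[OF that] by (metis sgn_greater sgn_signed_pow)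
    then show ?thesis using l by simp
  qed
  have "- W t \<noteq> 0 \<or> - W1 t \<noteq> 0"
    by (rule concave_arch_simple_zeros(3)[where F = "\<lambda>t. - W t" and ?F1.0 = "\<lambda>t. - W1 t"
          and ?F2.0 = "\<lambda>t. - (l * signed_pow q (U t))"])
      (use sol neg W_neg in \<open>auto simp: periodic_solution_def sym_periodic_def intro!: derivative_intros\<close>)
  then show ?thesis by simp
qed

text \<open>The frequency \<open>k / T\<close> fits \<open>k\<close> arches into
  \<open>{0..T}\<close>. The amplitude is the one for which \<open>U''\<close> is multiplied by
  \<open>T powr (- 1 / p)\<close>, which normalizes the norm.\<close>

definition SN :: "real \<Rightarrow> nat \<Rightarrow> real \<Rightarrow> real" where
  "SN T k t = T powr (2 - 1 / p) / (real k)\<^sup>2 * U (real k / T * t)"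

definition sn :: "real \<Rightarrow> nat \<Rightarrow> real" where
  "sn T k = real k powr (2 * q) * T powr (q / p - 1 - 2 * q) * l"

text \<open>The \<open>k\<close> arches contribute 1 each, and the change of variables divides by
  \<open>s\<close>; as \<open>k / s = T\<close>, the number of arches cancels.\<close>

lemma norm_scaled:
  assumes "0 < c" "0 < s" "0 < T" "s * T = real k"
  shows "integral {0..T} (\<lambda>t. \<bar>(c * s\<^sup>2) powr (p - 1) * W (s * t)\<bar> powr (p / (p - 1))) = (c * s\<^sup>2) powr p * T"
proof -
  have cW: "continuous_on UNIV (\<lambda>t. \<bar>W t\<bar> powr (p / (p - 1)))"
    using p periodic_solution_continuous(3)[OF sol]
    by (intro continuous_on_powr_pos continuous_intros) auto
  have sW: "sym_periodic 1 1 (\<lambda>t. \<bar>W t\<bar> powr (p / (p - 1)))"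
    using sol by (simp add: periodic_solution_def sym_periodic_def)
  have "integral {0..T} (\<lambda>t. \<bar>W (s * t + 0)\<bar> powr (p / (p - 1))) =
      integral {s * 0 + 0..s * T + 0} (\<lambda>t. \<bar>W t\<bar> powr (p / (p - 1))) / s"
    using assms by (intro integral_affine cW) auto
  also have "\<dots> = real k / s"
    using sym_periodic_integral[OF sW cW, of k] W_norm assms(4) by simp
  also have "\<dots> = T" using assms by (simp add: field_simps)
  finally have 1: "integral {0..T} (\<lambda>t. \<bar>W (s * t)\<bar> powr (p / (p - 1))) = T" by simp
  have "\<bar>(c * s\<^sup>2) powr (p - 1) * W (s * t)\<bar> powr (p / (p - 1)) =
      (c * s\<^sup>2) powr p * \<bar>W (s * t)\<bar> powr (p / (p - 1))" for t
    using assms p by (simp add: abs_mult powr_mult powr_powr)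
  then show ?thesis using 1 by simp
qed

lemma sn_eq:
  assumes "0 < T" "1 \<le> k"
  defines "c \<equiv> T powr (2 - 1 / p) / (real k)\<^sup>2" and "s \<equiv> real k / T"
  shows "c * s\<^sup>2 = T powr (- 1 / p)"
    and "(c * s\<^sup>2) powr (p - 1) * s\<^sup>2 * l / c powr (q - 1) = sn T k"
proof -
  have pos: "0 < c" "0 < s" using assms by (auto simp: c_def s_def)
  have "c * s\<^sup>2 = T powr (2 - 1 / p) / T powr 2"
    using assms by (simp add: c_def s_def power_divide)
  also have "\<dots> = T powr (- 1 / p)" by (simp add: powr_diff[symmetric])
  finally show cs: "c * s\<^sup>2 = T powr (- 1 / p)" .
  \<comment> \<open>Taking logarithms turns the identity of exponents into a linear one in
    \<open>ln T\<close>, \<open>ln k\<close> and \<open>ln l\<close>.\<close>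
  have "ln ((c * s\<^sup>2) powr (p - 1) * s\<^sup>2 * l / c powr (q - 1)) = ln (sn T k)"
    unfolding cs using assms pos l p
    by (simp add: sn_def ln_mult ln_div ln_powr powr_powr c_def s_def ln_realpow) (simp add: field_simps)
  moreover have "0 < (c * s\<^sup>2) powr (p - 1) * s\<^sup>2 * l / c powr (q - 1)" "0 < sn T k"
    using assms pos l by (auto simp: sn_def)
  ultimately show "(c * s\<^sup>2) powr (p - 1) * s\<^sup>2 * l / c powr (q - 1) = sn T k" by simp
qed

lemma spectral_couple_SN:
  assumes "0 < T" "1 \<le> k"
  shows "spectral_couple p q T (SN T k) (sn T k)"
proof -
  define c where "c = T powr (2 - 1 / p) / (real k)\<^sup>2"
  define s where "s = real k / T"
  have pos: "0 < c" "0 < s" using assms by (auto simp: c_def s_def)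
  note eq = sn_eq[OF assms, folded c_def s_def]
  have "real k * (1 / s) = T" using assms by (simp add: s_def)
  with periodic_solution_mult_nat[OF periodic_solution_scale[OF sol pos p], of k]
  have ps: "periodic_solution p q (sn T k) T (\<lambda>t. c * U (s * t)) (\<lambda>t. c * s * U1 (s * t))
     (\<lambda>t. (c * s\<^sup>2) powr (p - 1) * W (s * t)) (\<lambda>t. (c * s\<^sup>2) powr (p - 1) * s * W1 (s * t))"
    by (simp add: eq(2))
  have "(c * s\<^sup>2) powr p * T = 1"
    unfolding eq(1) powr_powr using assms p by (simp add: powr_neg_one)
  then have "integral {0..T} (\<lambda>t. \<bar>(c * s\<^sup>2) powr (p - 1) * W (s * t)\<bar> powr (p / (p - 1))) = 1"
    using norm_scaled[OF pos assms(1), of k] assms by (simp add: s_def)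
  moreover have "SN T k t = c * U (s * t)" for t by (simp add: SN_def c_def s_def)
  moreover have "0 < sn T k" using assms l by (simp add: sn_def)
  moreover have "0 < c * s * U1 (s * 0)" using pos U_simple(1) by simp
  ultimately show ?thesis using spectral_couple_iff[OF ps \<open>0 < T\<close> p q, of "SN T k"] by simp
qed

text \<open>Rescale the arch so that it has the eigenvalue and the slope at 0 of the given couple;
  uniqueness then identifies the two. The zero at \<open>T\<close> makes the frequency a multiple of
  \<open>1 / T\<close>, and the normalization fixes the amplitude.\<close>

lemma spectral_couple_is_SN:
  assumes g: "spectral_couple p q T g m" and "0 < T"
  obtains k where "1 \<le> k" "m = sn T k" "\<And>t. t \<in> {0..T} \<Longrightarrow> g t = SN T k t"
proof -
  obtain V V1 Z Z1 where V: "periodic_solution p q m T V V1 Z Z1" "\<And>t. t \<in> {0..T} \<Longrightarrow> g t = V t"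
    "0 < m" "0 < V1 0" "integral {0..T} (\<lambda>t. \<bar>Z t\<bar> powr (p / (p - 1))) = 1"
    using spectral_couple_periodic_solution[OF g \<open>0 < T\<close> p q] by metis
  define a where "a = V1 0 / U1 0"
  \<comment> \<open>Solves the two matching conditions: the slope requires \<open>c * s = a\<close>,
    and substituting \<open>c = a / s\<close> into the scaled eigenvalue leaves
    \<open>s powr (p + q) * a powr (p - q) * l = m\<close>.\<close>
  define s where "s = (m / l * a powr (q - p)) powr (1 / (p + q))"
  define c where "c = a / s"
  define d where "d = (c * s\<^sup>2) powr (p - 1)"
  have "0 < a" using V(4) U_simple(1) by (simp add: a_def)
  then have pos: "0 < s" "0 < c" using V(3) l by (auto simp: s_def c_def)
  have "s powr (p + q) = m / l * a powr (q - p)"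
    using V(3) l p q \<open>0 < a\<close> by (simp add: s_def powr_powr)
  then have "ln (s powr (p + q)) = ln (m / l * a powr (q - p))" by simp
  then have "(p + q) * ln s = ln m - ln l + (q - p) * ln a"
    using V(3) l \<open>0 < a\<close> pos by (simp add: ln_mult ln_div ln_powr)
  then have "ln (d * s\<^sup>2 * l / c powr (q - 1)) = ln m"
    unfolding d_def c_def using pos \<open>0 < a\<close> l V(3)
    by (simp add: ln_mult ln_div ln_powr ln_realpow algebra_simps)
  moreover have "0 < d * s\<^sup>2 * l / c powr (q - 1)" using pos l by (simp add: d_def)
  ultimately have m: "d * s\<^sup>2 * l / c powr (q - 1) = m" using V(3) by simp
  have scaled: "periodic_solution p q m (1 / s) (\<lambda>t. c * U (s * t)) (\<lambda>t. c * s * U1 (s * t))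
     (\<lambda>t. d * W (s * t)) (\<lambda>t. d * s * W1 (s * t))"
    using periodic_solution_scale[OF sol pos(2,1) p] unfolding d_def[symmetric] m .
  have slope: "V1 0 = c * s * U1 (s * 0)"
    using pos U_simple(1) by (simp add: c_def a_def)
  have "0 < d" using pos by (simp add: d_def)
  have VU: "V t = c * U (s * t) \<and> Z t = d * W (s * t)" if "0 \<le> t" for t
    by (rule periodic_solution_unique[OF V(1) scaled \<open>0 < T\<close> _ V(3) p q slope _ _ that])
      (use pos \<open>0 < d\<close> U_simple(3) W_simple in auto)
  have "V T = 0" using V(1) sym_periodic_odd_zero[of T V 1] by (simp add: periodic_solution_def)
  with VU[of T] pos \<open>0 < T\<close> have "U (s * T) = 0" by simp
  from U_simple(2)[OF this] obtain j where j: "s * T = of_int j" by (auto elim: Ints_cases)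
  have "0 < s * T" using pos \<open>0 < T\<close> by simp
  define k where "k = nat j"
  have k: "s * T = real k" "1 \<le> k" using j \<open>0 < s * T\<close> by (auto simp: k_def)
  then have s: "s = real k / T" using \<open>0 < T\<close> by (simp add: field_simps)
  have "integral {0..T} (\<lambda>t. \<bar>Z t\<bar> powr (p / (p - 1))) =
      integral {0..T} (\<lambda>t. \<bar>(c * s\<^sup>2) powr (p - 1) * W (s * t)\<bar> powr (p / (p - 1)))"
    using VU by (intro Henstock_Kurzweil_Integration.integral_cong) (simp add: d_def)
  then have "(c * s\<^sup>2) powr p * T = 1"
    using norm_scaled[OF pos(2,1) \<open>0 < T\<close> k(1)] V(5) by simp
  then have "(c * s\<^sup>2) powr p = T powr (- 1)"
    using \<open>0 < T\<close> by (simp add: powr_neg_one field_simps)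
  then have "((c * s\<^sup>2) powr p) powr (1 / p) = (T powr (- 1)) powr (1 / p)" by simp
  then have "c * s\<^sup>2 = T powr (- 1 / p)"
    unfolding powr_powr using pos p by simp
  also have "\<dots> = T powr (2 - 1 / p) / (real k)\<^sup>2 * s\<^sup>2"
    using sn_eq(1)[OF \<open>0 < T\<close> k(2)] s by simp
  finally have c: "c = T powr (2 - 1 / p) / (real k)\<^sup>2"
    unfolding mult_cancel_right using pos by simp
  show ?thesis
  proof (rule that[OF k(2)])
    show "m = sn T k"
      using m sn_eq(2)[OF \<open>0 < T\<close> k(2)] by (simp add: c s d_def)
    show "g t = SN T k t" if "t \<in> {0..T}" for t
      using V(2)[OF that] VU[of t] that by (simp add: SN_def c s)
  qed
qed

section \<open>Enumeration of the spectral numbers and counting of zeros\<close>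

lemma spectral_couple_cong:
  assumes "spectral_couple p q T f m" "0 < T" "\<And>t. t \<in> {0..T} \<Longrightarrow> g t = f t"
  shows "spectral_couple p q T g m"
proof -
  obtain V V1 Z Z1 where V: "periodic_solution p q m T V V1 Z Z1" "\<And>t. t \<in> {0..T} \<Longrightarrow> f t = V t"
    "0 < m" "0 < V1 0" "integral {0..T} (\<lambda>t. \<bar>Z t\<bar> powr (p / (p - 1))) = 1"
    using spectral_couple_periodic_solution[OF assms(1) \<open>0 < T\<close> p q] by metis
  then show ?thesis using spectral_couple_iff[OF V(1) \<open>0 < T\<close> p q, of g] assms(3) by simp
qed

lemma sn_less_iff: "0 < T \<Longrightarrow> sn T j < sn T k \<longleftrightarrow> j < k"
proof -
  assume "0 < T"
  have less: "sn T j < sn T k" if "j < k" for j k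
    using that \<open>0 < T\<close> l q unfolding sn_def
    by (intro mult_strict_right_mono powr_less_mono2) auto
  show ?thesis using less[of j k] less[of k j] by (cases j k rule: linorder_cases) auto
qed

lemma spectral_numbers_eq: "0 < T \<Longrightarrow> spectral_numbers p q T = sn T ` {1..}"
proof (intro equalityI subsetI)
  fix m assume "0 < T" "m \<in> spectral_numbers p q T"
  then obtain f where "spectral_couple p q T f m" by (auto simp: spectral_numbers_def)
  from spectral_couple_is_SN[OF this \<open>0 < T\<close>] show "m \<in> sn T ` {1..}" by auto
qed (use spectral_couple_SN in \<open>auto simp: spectral_numbers_def\<close>)

text \<open>\<open>sn T\<close> increases strictly, so exactly \<open>k - 1\<close> spectral numbers
  lie below \<open>sn T k\<close>; the \<open>Suc\<close> in the definition of the position restores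
  \<open>k\<close>.\<close>

lemma nth_spectral_number_iff:
  assumes "0 < T" "1 \<le> n"
  shows "nth_spectral_number p q T n m \<longleftrightarrow> m = sn T n"
proof -
  have inj: "inj (sn T)"
    using sn_less_iff[OF assms(1)] by (intro linorder_injI) (metis less_irrefl)
  have below: "{m \<in> spectral_numbers p q T. m < sn T k} = sn T ` {1..<k}" for k
    unfolding spectral_numbers_eq[OF assms(1)] using sn_less_iff[OF assms(1)] by auto
  have "nth_spectral_number p q T n (sn T k) \<longleftrightarrow> k = n" if "1 \<le> k" for k
    unfolding nth_spectral_number_def below
    using that by (auto simp: card_image[OF inj_on_subset[OF inj]] spectral_numbers_eq[OF assms(1)])
  moreover have "nth_spectral_number p q T n m \<Longrightarrow> m \<in> sn T ` {1..}"
    unfolding nth_spectral_number_def spectral_numbers_eq[OF assms(1)] by simp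
  ultimately show ?thesis using assms(2) by auto
qed

lemma nth_spectral_couple_iff:
  assumes "0 < T" "1 \<le> n"
  shows "nth_spectral_couple p q T n f m \<longleftrightarrow> m = sn T n \<and> (\<forall>t\<in>{0..T}. f t = SN T n t)"
proof
  assume *: "nth_spectral_couple p q T n f m"
  then have "m = sn T n" using nth_spectral_number_iff[OF assms] by (simp add: nth_spectral_couple_def)
  obtain k where k: "m = sn T k" "\<And>t. t \<in> {0..T} \<Longrightarrow> f t = SN T k t"
    using spectral_couple_is_SN[of T f m] * assms(1) by (auto simp: nth_spectral_couple_def)
  have "k = n" using k(1) \<open>m = sn T n\<close> sn_less_iff[OF assms(1)] by (metis less_irrefl linorder_less_linear)
  with k \<open>m = sn T n\<close> show "m = sn T n \<and> (\<forall>t\<in>{0..T}. f t = SN T n t)" by simp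
next
  assume "m = sn T n \<and> (\<forall>t\<in>{0..T}. f t = SN T n t)"
  then show "nth_spectral_couple p q T n f m"
    using spectral_couple_cong[OF spectral_couple_SN[OF assms] assms(1)] nth_spectral_number_iff[OF assms]
    by (simp add: nth_spectral_couple_def)
qed

text \<open>The zeros of \<open>U\<close> are exactly the integers, and the \<open>k - 1\<close>
  integers strictly between 0 and \<open>k\<close> are the ones hit inside the interval.\<close>

lemma zeros_SN:
  assumes "0 < T" "1 \<le> k"
  shows "finite {t \<in> {0<..<T}. SN T k t = 0}" "card {t \<in> {0<..<T}. SN T k t = 0} = k - 1"
proof -
  have U_int: "U (of_int j) = 0" for j
    using sol sym_periodic_odd_zero[of 1 U j] by (simp add: periodic_solution_def)
  have "{t \<in> {0<..<T}. SN T k t = 0} = (\<lambda>j. real j * T / real k) ` {1..<k}"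
  proof (intro equalityI subsetI)
    fix t assume "t \<in> {t \<in> {0<..<T}. SN T k t = 0}"
    then have t: "0 < t" "t < T" "U (real k / T * t) = 0" using assms by (auto simp: SN_def)
    from U_simple(2)[OF t(3)] obtain j where j: "real k / T * t = of_int j" by (auto elim: Ints_cases)
    have "0 < real k / T * t" "real k / T * t < real k" using t assms by (auto simp: field_simps)
    with j have "0 < j" "j < int k" by auto
    moreover from this have "t = real (nat j) * T / real k" using j assms by (simp add: field_simps)
    ultimately show "t \<in> (\<lambda>j. real j * T / real k) ` {1..<k}" by (intro image_eqI[of _ _ "nat j"]) auto
  next
    fix t assume "t \<in> (\<lambda>j. real j * T / real k) ` {1..<k}"
    then obtain j where "j \<in> {1..<k}" and t: "t = real j * T / real k" by blast
    then have j: "1 \<le> j" "j < k" by auto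
    have "SN T k t = 0" using assms U_int[of "int j"] by (simp add: SN_def t)
    moreover have "0 < t" "t < T"
      using j assms by (simp_all add: t pos_divide_less_eq mult.commute)
    ultimately show "t \<in> {t \<in> {0<..<T}. SN T k t = 0}" by simp
  qed
  moreover have "inj_on (\<lambda>j. real j * T / real k) {1..<k}" using assms by (auto simp: inj_on_def)
  ultimately show "finite {t \<in> {0<..<T}. SN T k t = 0}" "card {t \<in> {0<..<T}. SN T k t = 0} = k - 1"
    by (simp_all add: card_image)
qed

lemma spectral_couple_with_zeros_iff:
  assumes "0 < T" "1 \<le> n"
  shows "spectral_couple_with_zeros p q T (n - 1) f m \<longleftrightarrow> m = sn T n \<and> (\<forall>t\<in>{0..T}. f t = SN T n t)"
proof -
  have zeros: "{t \<in> {0<..<T}. f t = 0} = {t \<in> {0<..<T}. SN T k t = 0}"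
    if "\<And>t. t \<in> {0..T} \<Longrightarrow> f t = SN T k t" for k
    using that by auto
  show ?thesis
  proof
    assume *: "spectral_couple_with_zeros p q T (n - 1) f m"
    then obtain k where k: "1 \<le> k" "m = sn T k" "\<And>t. t \<in> {0..T} \<Longrightarrow> f t = SN T k t"
      using spectral_couple_is_SN[of T f m] assms(1) by (auto simp: spectral_couple_with_zeros_def)
    with * zeros[OF k(3)] zeros_SN[OF assms(1) k(1)] have "k - 1 = n - 1"
      by (simp add: spectral_couple_with_zeros_def)
    \<comment> \<open>Truncated subtraction loses nothing here since \<open>k\<close> and
      \<open>n\<close> are both at least 1.\<close>
    with k assms show "m = sn T n \<and> (\<forall>t\<in>{0..T}. f t = SN T n t)" by (cases k; cases n) auto
  next
    assume *: "m = sn T n \<and> (\<forall>t\<in>{0..T}. f t = SN T n t)"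
    then show "spectral_couple_with_zeros p q T (n - 1) f m"
      using spectral_couple_cong[OF spectral_couple_SN[OF assms] assms(1)] zeros_SN[OF assms] zeros[of n]
      by (simp add: spectral_couple_with_zeros_def)
  qed
qed

lemma is_the_couple_SN:
  assumes "0 < T" "1 \<le> n" "\<And>t. f t = SN T n t" "m = sn T n"
  shows "is_the_couple T (nth_spectral_couple p q T n) f m"
    and "is_the_couple T (spectral_couple_with_zeros p q T (n - 1)) f m"
  unfolding is_the_couple_def nth_spectral_couple_iff[OF assms(1,2)]
    spectral_couple_with_zeros_iff[OF assms(1,2)]
  using assms(3,4) by simp_all

lemma SN_1: "SN 1 n t = U (real n * t) / (real n)\<^sup>2"
  by (simp add: SN_def)

text \<open>\<open>U\<close> is itself odd with period 2, and such a function is determined by its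
  values on \<open>{0..1}\<close>. Hence every extension of a first eigenfunction is the global
  reference solution.\<close>

lemma odd_2periodic_extension_iff:
  assumes "\<And>t. t \<in> {0..1} \<Longrightarrow> f t = U t"
  shows "odd_2periodic_extension f g \<longleftrightarrow> g = U"
proof -
  have "sym_periodic (- 1) 1 U" using sol by (simp add: periodic_solution_def)
  moreover have "odd_2periodic_extension f g \<longleftrightarrow>
      sym_periodic (- 1) 1 g \<and> (\<forall>t\<in>{0..1}. g t = U t)" for g
    using assms by (auto simp: odd_2periodic_extension_def sym_periodic_def)
  ultimately show ?thesis using sym_periodic_eqI[of "- 1" 1 g U] by (auto intro!: ext)
qed

end

theorem lemma7p1:
  fixes p q t0 :: real and n :: nat
  assumes "1 < p" and "1 < q" and "t0 > 0" and "n \<ge> 1"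
  shows
    "(\<exists>f l. is_the_couple t0 (spectral_couple_with_zeros p q t0 (n - 1)) f l) \<and>
     (\<exists>f1 l1. is_the_couple 1 (nth_spectral_couple p q 1 1) f1 l1) \<and>
     (\<forall>f1 l1. nth_spectral_couple p q 1 1 f1 l1 \<longrightarrow>
       (\<exists>!f1s. odd_2periodic_extension f1 f1s) \<and>
       (\<forall>f1s. odd_2periodic_extension f1 f1s \<longrightarrow>
         (let fn = (\<lambda>t. f1s (real n * t) / (real n)^2);
              ln = real n powr (2 * q) * l1;
              SN = (\<lambda>t. t0 powr (2 - 1 / p) * fn (t / t0));
              sn = t0 powr (q / p - 1 - 2 * q) * ln
          in is_the_couple 1 (nth_spectral_couple p q 1 n) fn ln \<and>
             is_the_couple t0 (spectral_couple_with_zeros p q t0 (n - 1)) SN sn \<and>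
             (\<forall>t. SN t = t0 powr (2 - 1 / p) / (real n)^2 * f1s (real n * t / t0)) \<and>
             sn = real n powr (2 * q) * t0 powr (q / p - 1 - 2 * q) * l1 \<and>
             is_the_couple t0 (nth_spectral_couple p q t0 n) SN sn)))"
proof -
  obtain l U U1 W W1 where base: "periodic_solution p q l 1 U U1 W W1" "0 < l"
    "\<And>t. t \<in> {0<..<1} \<Longrightarrow> 0 < U t" "\<And>t. t \<in> {0<..<1} \<Longrightarrow> W t < 0"
    "integral {0..1} (\<lambda>t. \<bar>W t\<bar> powr (p / (p - 1))) = 1"
    using positive_solution_exists[OF assms(1,2)] by metis
  interpret positive_solution p q l U U1 W W1
    using base assms by unfold_locales
  show ?thesis
  proof (intro conjI allI impI)
    show "\<exists>f l. is_the_couple t0 (spectral_couple_with_zeros p q t0 (n - 1)) f l"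
      using is_the_couple_SN(2)[OF assms(3,4)] by blast
    show "\<exists>f1 l1. is_the_couple 1 (nth_spectral_couple p q 1 1) f1 l1"
      using is_the_couple_SN(1)[of 1 1] by auto
  next
    fix f1 l1 assume "nth_spectral_couple p q 1 1 f1 l1"
    \<comment> \<open>For \<open>T = 1\<close> and \<open>n = 1\<close> all scaling factors are 1,
      so the first couple is the reference arch, and the claimed formulas become instances of
      \<open>SN\<close> and \<open>sn\<close>.\<close>
    then have f1: "\<And>t. t \<in> {0..1} \<Longrightarrow> f1 t = U t" and l1: "l1 = l"
      using nth_spectral_couple_iff[of 1 1 f1 l1] by (auto simp: SN_1 sn_def)
    show "\<exists>!f1s. odd_2periodic_extension f1 f1s"
      using odd_2periodic_extension_iff[OF f1] by simp
    fix f1s assume "odd_2periodic_extension f1 f1s"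
    then have f1s: "f1s = U" using odd_2periodic_extension_iff[OF f1] by simp
    show "let fn = (\<lambda>t. f1s (real n * t) / (real n)^2);
              ln = real n powr (2 * q) * l1;
              SN = (\<lambda>t. t0 powr (2 - 1 / p) * fn (t / t0));
              sn = t0 powr (q / p - 1 - 2 * q) * ln
          in is_the_couple 1 (nth_spectral_couple p q 1 n) fn ln \<and>
             is_the_couple t0 (spectral_couple_with_zeros p q t0 (n - 1)) SN sn \<and>
             (\<forall>t. SN t = t0 powr (2 - 1 / p) / (real n)^2 * f1s (real n * t / t0)) \<and>
             sn = real n powr (2 * q) * t0 powr (q / p - 1 - 2 * q) * l1 \<and>
             is_the_couple t0 (nth_spectral_couple p q t0 n) SN sn"
      unfolding Let_def f1s l1
      by (intro conjI allI is_the_couple_SN assms zero_less_one) (simp_all add: SN_def sn_def)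
  qed
qed

end
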